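(* For every distributive $\langle\vee,0\rangle$-semilattice $S$, there are a meet-semilattice $P$ with a least element $0$ and an $S$-valued p-measure $\Vert{-}\leq{-}\Vert$ on $P$ satisfying the following additional conditions: (i) $\Vert y=x\Vert>0$ for all $x<y$ in $P$. (ii) For all $x\leq y$ in $P$ and all $\boldsymbol{a},\boldsymbol{b}\in S$, if $\Vert y=x\Vert\leq\boldsymbol{a}\vee\boldsymbol{b}$, then there are a positive integer $n$ and a decomposition $x=z_0\leq z_1\leq\dots\leq z_n=y$ in $P$ such that either $\Vert z_{i+1}=z_i\Vert\leq\boldsymbol{a}$ or $\Vert z_{i+1}=z_i\Vert\leq\boldsymbol{b}$, for all $i<n$. (iii) The subset $\{\Vert x=0\Vert\mid x\in P\}$ generates the semilattice $S$. Furthermore, if $S$ is bounded (i.e. has a largest element), then $P$ can be taken a bounded lattice.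
   Context: A $\langle\vee,0\rangle$-semilattice is a join-semilattice with least element $0$. A join-semilattice $S$ is distributive if for all $\boldsymbol{a},\boldsymbol{b},\boldsymbol{c}\in S$ with $\boldsymbol{c}\leq\boldsymbol{a}\vee\boldsymbol{b}$ there are $\boldsymbol{x}\leq\boldsymbol{a}$ and $\boldsymbol{y}\leq\boldsymbol{b}$ in $S$ such that $\boldsymbol{c}=\boldsymbol{x}\vee\boldsymbol{y}$. An $S$-valued p-measure on a poset $P$ is a map $P\times P\to S$, $(x,y)\mapsto\Vert x\leq y\Vert$, such that $\Vert x\leq z\Vert\leq\Vert x\leq y\Vert\vee\Vert y\leq z\Vert$ for all $x,y,z\in P$, and $x\leq y$ implies $\Vert x\leq y\Vert=0$. For comparable $x,y\in P$, $\Vert x=y\Vert$ denotes $\Vert\max\{x,y\}\leq\min\{x,y\}\Vert$; so $\Vert y=x\Vert=\Vert y\leq x\Vert$ (the value of the p-measure at the pair $(y,x)$) whenever $x\leq y$. *)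

theory Defs
  imports Main "HOL.Hull" "HOL-Algebra.Lattice"
begin

text \<open>
  The semilattice \<open>S\<close> is a type \<open>'a :: bounded_semilattice_sup_bot\<close>, because it is universally
  quantified. The poset \<open>P\<close> is existentially quantified, so it lives on a carrier set, in the form
  of a \<open>gorder\<close> record. The locale \<open>partial_order\<close>, on which \<open>lower_semilattice\<close> and
  \<open>bounded_lattice\<close> build, forces the \<open>eq\<close> field of the record to be equality.

  As types cannot be quantified existentially, a type for the elements of \<open>P\<close> has to be fixed; it
  will be \<open>('a + nat) list\<close>, of cardinality \<open>max (card S) \<aleph>\<^sub>0\<close>. This costs no generality: closing a
  subset of an arbitrary \<open>P\<close> under the zero, binary meets (and, in the bounded case, the unit and
  binary joins), and chosen decompositions and generators gives a solution of at most that
  cardinality.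
\<close>

definition distributive_semilattice :: "'a::semilattice_sup itself \<Rightarrow> bool"
  where "distributive_semilattice _ \<longleftrightarrow>
    (\<forall>a b c :: 'a. c \<le> sup a b \<longrightarrow> (\<exists>x y. x \<le> a \<and> y \<le> b \<and> c = sup x y))"

text \<open>\<open>m x y\<close> stands for \<open>\<parallel>x \<le> y\<parallel>\<close>; its values outside the carrier are irrelevant.\<close>

definition p_measure ::
    "('b, 'r) gorder_scheme \<Rightarrow> ('b \<Rightarrow> 'b \<Rightarrow> 'a::bounded_semilattice_sup_bot) \<Rightarrow> bool"
  where "p_measure P m \<longleftrightarrow>
    (\<forall>x \<in> carrier P. \<forall>y \<in> carrier P. \<forall>z \<in> carrier P. m x z \<le> sup (m x y) (m y z)) \<and>
    (\<forall>x \<in> carrier P. \<forall>y \<in> carrier P. x \<sqsubseteq>\<^bsub>P\<^esub> y \<longrightarrow> m x y = bot)"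

text \<open>
  \<open>\<parallel>x = y\<parallel>\<close>, that is \<open>\<parallel>max {x, y} \<le> min {x, y}\<parallel>\<close>. It is meaningful only for comparable
  \<open>x\<close> and \<open>y\<close>.
\<close>

definition eq_measure ::
    "('b, 'r) gorder_scheme \<Rightarrow> ('b \<Rightarrow> 'b \<Rightarrow> 'a) \<Rightarrow> 'b \<Rightarrow> 'b \<Rightarrow> 'a"
  where "eq_measure P m x y = (if x \<sqsubseteq>\<^bsub>P\<^esub> y then m y x else m x y)"

text \<open>
  Closure under binary joins is all that is asked. The zero need not be added by hand in the
  application below, as it is the measure \<open>\<parallel>0 = 0\<parallel>\<close>.
\<close>

definition generates_semilattice :: "'a::semilattice_sup set \<Rightarrow> bool"
  where "generates_semilattice X \<longleftrightarrow>
    (\<lambda>T. \<forall>a \<in> T. \<forall>b \<in> T. sup a b \<in> T) hull X = UNIV"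

end

theory Submission
  imports Defs
begin

text \<open>
  Call \<open>\<parallel>x \<le> y\<parallel>\<close> the gap from \<open>x\<close> to \<open>y\<close>. The space \<open>P\<close> is built from free intervals. The interval
  \<open>T(c)\<close> has a least point \<open>Bot\<close> and a greatest point \<open>Top\<close> with \<open>\<parallel>Top \<le> Bot\<parallel> = c\<close>. For every
  decomposition \<open>c = a \<squnion> b\<close> into nonzero elements it contains a chain \<open>Bot < n1 < n2 < n3 < Top\<close> whose
  four links have the gaps \<open>a\<close>, \<open>b\<close>, \<open>b\<close>, \<open>a\<close>. Different chains meet only in \<open>Bot\<close> and \<open>Top\<close>, and every
  link of gap \<open>e\<close> is filled with a copy of \<open>T(e)\<close>, without end. This order is series-parallel, hence a
  lattice, and between comparable points gaps add up along a chain. So condition (ii) only has to be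
  checked for a single link, where it is the definition of distributivity, and condition (i) holds
  because only nonzero links are ever inserted.

  The difficulty is to define the gap between points \<open>p\<close> and \<open>q\<close> that lie on different chains of the
  same link. If \<open>S\<close> had meets, they would give canonical values. In a distributive semilattice values
  with the required properties exist, but they have to be chosen, and choices made for infinitely many
  pairs must obey the triangle inequality. Two ideas make this possible.

  First, every chain runs through its decomposition twice. As \<open>a \<squnion> b = c\<close>, a point \<open>p\<close> of the lower half
  of a chain has \<open>\<parallel>Top \<le> p\<parallel> = c\<close>, and a point of the upper half has \<open>\<parallel>p \<le> Bot\<parallel> = c\<close>. This leaves room to
  give the gap from \<open>p\<close> to \<open>q\<close> its greatest conceivable value \<open>\<parallel>p \<le> Bot\<parallel>\<close> when \<open>q\<close> is in the lower half of
  its chain, and \<open>\<parallel>Top \<le> q\<parallel>\<close> when \<open>p\<close> is in the upper half of its chain; only for lower \<open>p\<close> and upper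
  \<open>q\<close> is there a choice. For three points \<open>p\<close>, \<open>q\<close>, \<open>r\<close> with \<open>q\<close> on a chain of its own, the triangle
  inequality then holds whatever was chosen: one of the two gaps on the right is as great as
  possible. Hence only two chains at a time have to be made compatible (\<open>gap_triangle\<close>).

  Secondly, for two chains the choice is made along the nesting of links. For fixed \<open>p\<close> the function
  \<open>q \<mapsto> \<parallel>p \<le> q\<parallel>\<close> is an upper profile: it decreases, it drops over a link by at most the gap of the link,
  and it is constant on lower halves. When \<open>p\<close> is a new node between the ends of a link, its profile
  has to interpolate between the profiles of the ends; it is built node by node in the
  variable \<open>q\<close> (\<open>upper_profile_interpolant\<close>), and each single value exists by distributivity
  (\<open>interpolation\<close>).

  If \<open>S\<close> has a largest element \<open>u\<close>, then \<open>P = T(u)\<close> (or a point, when \<open>u = 0\<close>). Otherwise \<open>P\<close> consists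
  of all \<open>T(c)\<close> with \<open>c \<noteq> 0\<close>, glued together at their least points. In either case every element of \<open>S\<close>
  is some \<open>\<parallel>x \<le> 0\<parallel>\<close>, which gives condition (iii).
\<close>

no_notation join (infixl \<open>\<squnion>\<index>\<close> 65)
notation sup (infixl \<open>\<squnion>\<close> 65)

section \<open>Interpolation in distributive semilattices\<close>

text \<open>
  A substitute for \<open>s = e \<sqinter> \<Sqinter>U\<close>: distributivity splits off the part of \<open>e\<close> below one \<open>u\<close> at a time,
  and what is split off each time lies below \<open>b\<close>.
\<close>

lemma lower_part_below_all:
  fixes e b :: "'a::semilattice_sup"
  assumes dist: "distributive_semilattice TYPE('a)"
    and "finite U" "U \<noteq> {}" "\<And>u. u \<in> U \<Longrightarrow> e \<le> u \<squnion> b"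
  shows "\<exists>s. s \<le> e \<and> (\<forall>u \<in> U. s \<le> u) \<and> e \<le> s \<squnion> b"
  using assms(2,3,4)
proof (induction U rule: finite_ne_induct)
  case (singleton u)
  then obtain s t where "s \<le> u" "t \<le> b" "e = s \<squnion> t"
    using dist unfolding distributive_semilattice_def by (metis insertI1)
  then show ?case by (intro exI[of _ s]) (simp add: le_supI2)
next
  case (insert u U)
  then obtain s where s: "s \<le> e" "\<forall>u \<in> U. s \<le> u" "e \<le> s \<squnion> b" by auto
  have "s \<le> u \<squnion> b" using s(1) insert.prems[of u] by (auto intro: order_trans)
  then obtain s' t where s': "s' \<le> u" "t \<le> b" "s = s' \<squnion> t"
    using dist unfolding distributive_semilattice_def by metis
  have "s' \<le> s" using s' by simp
  moreover have "e \<le> s' \<squnion> b"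
    using s(3) s' by (simp add: sup.assoc sup.absorb2)
  ultimately show ?case using s s'(1) by (intro exI[of _ s']) (auto intro: order_trans)
qed

text \<open>
  With meets one would take \<open>x = \<Sqinter>U\<close>. The join of the lower bounds with the two approximations
  of \<open>e1 \<sqinter> \<Sqinter>U\<close> and \<open>e2 \<sqinter> \<Sqinter>U\<close> serves the same purpose.
\<close>

lemma interpolation:
  fixes b1 b2 :: "'a::semilattice_sup"
  assumes dist: "distributive_semilattice TYPE('a)"
    and fin: "finite L" "finite U" "U \<noteq> {}"
    and LU: "\<And>l u. l \<in> L \<Longrightarrow> u \<in> U \<Longrightarrow> l \<le> u"
    and e1: "\<And>u. u \<in> U \<Longrightarrow> e1 \<le> u \<squnion> b1"
    and e2: "\<And>u. u \<in> U \<Longrightarrow> e2 \<le> u \<squnion> b2"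
  shows "\<exists>x. (\<forall>l \<in> L. l \<le> x) \<and> (\<forall>u \<in> U. x \<le> u) \<and> e1 \<le> x \<squnion> b1 \<and> e2 \<le> x \<squnion> b2"
proof -
  obtain s1 where s1: "\<forall>u \<in> U. s1 \<le> u" "e1 \<le> s1 \<squnion> b1"
    using lower_part_below_all[OF dist fin(2,3) e1] by blast
  obtain s2 where s2: "\<forall>u \<in> U. s2 \<le> u" "e2 \<le> s2 \<squnion> b2"
    using lower_part_below_all[OF dist fin(2,3) e2] by blast
  define x where "x = Sup_fin (insert s1 (insert s2 L))"
  have ge: "l \<le> x" if "l \<in> insert s1 (insert s2 L)" for l
    unfolding x_def using that fin(1) by (intro Sup_fin.coboundedI) auto
  have "x \<le> u" if "u \<in> U" for u
    unfolding x_def using that fin(1) s1 s2 LU by (subst Sup_fin.bounded_iff) auto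
  moreover have "e1 \<le> x \<squnion> b1" "e2 \<le> x \<squnion> b2"
    using s1(2) s2(2) ge by (meson insertCI order_refl order_trans sup_mono)+
  ultimately show ?thesis using ge by blast
qed

section \<open>The points of an interval and their gaps from its ends\<close>

text \<open>
  \<open>In a b k p\<close> is the point \<open>p\<close> of the interval that fills the link number \<open>k\<close> of the chain for the
  decomposition \<open>(a, b)\<close>; the links are numbered from 0 to 3, and \<open>In a b k Bot\<close> is the node below
  link \<open>k\<close>. Ends of links therefore have several names: \<open>In a b 0 Bot\<close> denotes the same point as \<open>Bot\<close>,
  \<open>In a b k Top\<close> the same as \<open>In a b (k + 1) Bot\<close>, and \<open>In a b 3 Top\<close> the same as \<open>Top\<close>.
\<close>

datatype 'a pt = Bot | Top | In 'a 'a nat "'a pt"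

definition link :: "'a \<Rightarrow> 'a \<Rightarrow> nat \<Rightarrow> 'a" where
  "link a b k = (if k = 0 \<or> k = 3 then a else b)"

text \<open>
  All names are admitted here, so that a function on the points of an interval can be restricted to
  a link including both its ends. The order, which needs unique names, uses \<open>point\<close> below.
\<close>

fun pre_point :: "'a::semilattice_sup \<Rightarrow> 'a pt \<Rightarrow> bool" where
  "pre_point c Bot = True"
| "pre_point c Top = True"
| "pre_point c (In a b k p) = (a \<squnion> b = c \<and> k < 4 \<and> pre_point (link a b k) p)"

text \<open>
  The gaps \<open>\<parallel>p \<le> Bot\<parallel>\<close> and \<open>\<parallel>Top \<le> p\<parallel>\<close> in an interval of gap \<open>c\<close>, obtained by adding up along the chain
  of \<open>p\<close>. The value \<open>c\<close> is reached at the middle node, since the links of either half join to \<open>a \<squnion> b\<close>.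
\<close>

fun above_bot :: "'a::bounded_semilattice_sup_bot \<Rightarrow> 'a pt \<Rightarrow> 'a" where
  "above_bot c Bot = bot"
| "above_bot c Top = c"
| "above_bot c (In a b k p) =
    (if k = 0 then above_bot a p else if k = 1 then a \<squnion> above_bot b p else c)"

fun below_top :: "'a::bounded_semilattice_sup_bot \<Rightarrow> 'a pt \<Rightarrow> 'a" where
  "below_top c Bot = c"
| "below_top c Top = bot"
| "below_top c (In a b k p) =
    (if k < 2 then c else if k = 2 then below_top b p \<squnion> a else below_top a p)"

lemma above_bot_le: "pre_point c p \<Longrightarrow> above_bot c p \<le> c"
  by (induction p arbitrary: c) (auto simp: link_def intro: le_supI1 le_supI2)

lemma below_top_le: "pre_point c p \<Longrightarrow> below_top c p \<le> c"
  by (induction p arbitrary: c) (auto simp: link_def intro: le_supI1 le_supI2)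

lemma le_above_below: "c \<le> above_bot c p \<squnion> below_top c p"
  by (cases p) auto

section \<open>Upper profiles\<close>

text \<open>
  These are the functions that occur as \<open>q \<mapsto> \<parallel>p \<le> q\<parallel>\<close> for \<open>p\<close> on a parallel chain. Links are nested
  without end, so the conditions on \<open>g\<close> are imposed coinductively; the equations at \<open>Bot\<close> and \<open>Top\<close> say
  that \<open>g\<close> does not depend on the name chosen for an end of a link.
\<close>

coinductive upper_profile :: "'a::bounded_semilattice_sup_bot \<Rightarrow> ('a pt \<Rightarrow> 'a) \<Rightarrow> bool" where
  "\<lbrakk>g Top \<le> g Bot; g Bot \<le> g Top \<squnion> d;
    \<And>a b. a \<squnion> b = d \<Longrightarrow> (\<forall>k q. k < 2 \<longrightarrow> g (In a b k q) = g Bot) \<and>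
      g (In a b 2 Bot) = g Bot \<and> g (In a b 2 Top) = g (In a b 3 Bot) \<and> g (In a b 3 Top) = g Top \<and>
      upper_profile b (\<lambda>q. g (In a b 2 q)) \<and> upper_profile a (\<lambda>q. g (In a b 3 q))\<rbrakk>
    \<Longrightarrow> upper_profile d g"

lemma upper_profileD:
  assumes "upper_profile d g"
  shows "g Top \<le> g Bot" "g Bot \<le> g Top \<squnion> d"
    and "\<And>a b k q. a \<squnion> b = d \<Longrightarrow> k < 2 \<Longrightarrow> g (In a b k q) = g Bot"
    and "\<And>a b. a \<squnion> b = d \<Longrightarrow> g (In a b 2 Bot) = g Bot"
    and "\<And>a b. a \<squnion> b = d \<Longrightarrow> g (In a b 2 Top) = g (In a b 3 Bot)"
    and "\<And>a b. a \<squnion> b = d \<Longrightarrow> g (In a b 3 Top) = g Top"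
    and "\<And>a b. a \<squnion> b = d \<Longrightarrow> upper_profile b (\<lambda>q. g (In a b 2 q))"
    and "\<And>a b. a \<squnion> b = d \<Longrightarrow> upper_profile a (\<lambda>q. g (In a b 3 q))"
  by (rule upper_profile.cases[OF assms]; blast)+

lemma upper_profile_const: "upper_profile d (\<lambda>_. x)"
  by (coinduction arbitrary: d) auto

text \<open>
  The constant \<open>x\<close> is for the coinduction: on the third link of a chain, \<open>below_top d\<close> restricts to the
  \<open>below_top\<close> of the link, increased by the gap of the fourth link.
\<close>

lemma upper_profile_below_top: "upper_profile d (\<lambda>q. below_top d q \<squnion> x)"
proof (coinduction arbitrary: d x)
  case upper_profile
  let ?f = "\<lambda>q. below_top d q \<squnion> x"
  let ?P = "\<lambda>d h. \<exists>d' x. d = d' \<and> h = (\<lambda>q. below_top d' q \<squnion> x)"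
  have "?P b (\<lambda>q. ?f (In a b 2 q)) \<and> ?P a (\<lambda>q. ?f (In a b 3 q))" for a b
    by (intro conjI exI[of _ b] exI[of _ a] exI[of _ "a \<squnion> x"] exI[of _ x])
      (simp_all add: sup.assoc)
  moreover have "(\<forall>k q. k < 2 \<longrightarrow> ?f (In a b k q) = ?f Bot) \<and> ?f (In a b 2 Bot) = ?f Bot \<and>
      ?f (In a b 2 Top) = ?f (In a b 3 Bot) \<and> ?f (In a b 3 Top) = ?f Top"
    if "a \<squnion> b = d" for a b
    using that by (auto simp: ac_simps)
  moreover have "?f Top \<le> ?f Bot" "?f Bot \<le> ?f Top \<squnion> d" by (simp_all add: sup.commute)
  ultimately show ?case by (intro exI[of _ ?f] exI[of _ d]) blast
qed

lemma upper_profile_bounds: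
  "upper_profile d g \<Longrightarrow> pre_point d q \<Longrightarrow> g Top \<le> g q \<and> g q \<le> g Bot"
proof (induction q arbitrary: d g)
  case (In a b k q)
  note D = upper_profileD[OF In.prems(1)]
  have ab: "a \<squnion> b = d" "k < 4" "pre_point (link a b k) q" using In.prems(2) by auto
  consider "k < 2" | "k = 2" | "k = 3" using ab(2) by linarith
  then show ?case
  proof cases
    case 1
    then show ?thesis using D(1) D(3)[OF ab(1)] by simp
  next
    case 2
    then show ?thesis
      using In.IH[OF D(7)[OF ab(1)]] ab(3) D(4-6)[OF ab(1)] upper_profileD(1)[OF D(8)[OF ab(1)]]
      by (auto simp: link_def intro: order_trans)
  next
    case 3
    then show ?thesis
      using In.IH[OF D(8)[OF ab(1)]] ab(3) D(4-6)[OF ab(1)] upper_profileD(1)[OF D(7)[OF ab(1)]]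
      by (auto simp: link_def intro: order_trans)
  qed
qed (auto dest: upper_profileD)

section \<open>Interpolating profiles\<close>

text \<open>
  If \<open>x0 \<le> x1\<close> are the gaps from the lower and from the upper end of a link to some point, then \<open>x\<close>
  is a possible gap from a node that splits the link into parts \<open>a\<close> (below) and \<open>b\<close> (above).
\<close>

definition between :: "'a::bounded_semilattice_sup_bot \<Rightarrow> 'a \<Rightarrow> 'a \<Rightarrow> 'a \<Rightarrow> 'a \<Rightarrow> bool" where
  "between a b x0 x1 x \<longleftrightarrow> x0 \<le> x \<and> x \<le> x1 \<and> x \<le> x0 \<squnion> a \<and> x1 \<le> x \<squnion> b"

text \<open>
  The value at the node \<open>In a' b' 3 Bot\<close> of a profile interpolating between \<open>g0\<close> and \<open>g1\<close>, when its
  values \<open>s\<close> at \<open>Bot\<close> and \<open>t\<close> at \<open>Top\<close> are known. It is constrained in two directions: by \<open>s\<close> and \<open>t\<close>, and by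
  the values of \<open>g0\<close> and \<open>g1\<close> at the node. Only this node matters, as the profile equals \<open>s\<close> on the lower
  half.
\<close>

definition node_value :: "'a::bounded_semilattice_sup_bot \<Rightarrow> 'a \<Rightarrow> ('a pt \<Rightarrow> 'a) \<Rightarrow> ('a pt \<Rightarrow> 'a)
    \<Rightarrow> 'a \<Rightarrow> 'a \<Rightarrow> 'a \<Rightarrow> 'a \<Rightarrow> 'a" where
  "node_value a b g0 g1 s t a' b' =
    (SOME x. between a' b' t s x \<and> between a b (g0 (In a' b' 3 Bot)) (g1 (In a' b' 3 Bot)) x)"

fun interpolant :: "'a::bounded_semilattice_sup_bot \<Rightarrow> 'a \<Rightarrow> ('a pt \<Rightarrow> 'a) \<Rightarrow> ('a pt \<Rightarrow> 'a)
    \<Rightarrow> 'a \<Rightarrow> 'a \<Rightarrow> 'a pt \<Rightarrow> 'a" where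
  "interpolant a b g0 g1 s t Bot = s"
| "interpolant a b g0 g1 s t Top = t"
| "interpolant a b g0 g1 s t (In a' b' k q) =
    (let x = node_value a b g0 g1 s t a' b'
     in if k < 2 then s
        else if k = 2 then interpolant a b (\<lambda>q. g0 (In a' b' 2 q)) (\<lambda>q. g1 (In a' b' 2 q)) s x q
        else interpolant a b (\<lambda>q. g0 (In a' b' 3 q)) (\<lambda>q. g1 (In a' b' 3 q)) x t q)"

text \<open>
  The situation in which an interpolating profile with values \<open>s\<close> at \<open>Bot\<close> and \<open>t\<close> at \<open>Top\<close> can be
  found; the point of the conditions is that they pass to the links of the upper half.
\<close>

definition interpolable :: "'a::bounded_semilattice_sup_bot \<Rightarrow> 'a \<Rightarrow> 'a \<Rightarrow> ('a pt \<Rightarrow> 'a) \<Rightarrow> ('a pt \<Rightarrow> 'a)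
    \<Rightarrow> 'a \<Rightarrow> 'a \<Rightarrow> bool" where
  "interpolable a b d g0 g1 s t \<longleftrightarrow> upper_profile d g0 \<and> upper_profile d g1 \<and>
    (\<forall>q. pre_point d q \<longrightarrow> g0 q \<le> g1 q \<and> g1 q \<le> g0 q \<squnion> (a \<squnion> b)) \<and>
    between a b (g0 Bot) (g1 Bot) s \<and> between a b (g0 Top) (g1 Top) t \<and>
    t \<le> s \<and> s \<le> t \<squnion> d"

text \<open>
  Of the bounds on the value at the new node, some come from \<open>s\<close> and \<open>t\<close>, the others from \<open>g0\<close> and
  \<open>g1\<close>. Two bounds of different origin are compatible by a detour through the value of \<open>g0\<close> or \<open>g1\<close> at an
  end of the interval.
\<close>

lemma interpolable_step:
  fixes a b d :: "'a::bounded_semilattice_sup_bot"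
  assumes dist: "distributive_semilattice TYPE('a)"
    and i: "interpolable a b d g0 g1 s t" and d: "a' \<squnion> b' = d"
    and x: "x = node_value a b g0 g1 s t a' b'"
  shows "interpolable a b b' (\<lambda>q. g0 (In a' b' 2 q)) (\<lambda>q. g1 (In a' b' 2 q)) s x"
    and "interpolable a b a' (\<lambda>q. g0 (In a' b' 3 q)) (\<lambda>q. g1 (In a' b' 3 q)) x t"
proof -
  define x0 where "x0 = g0 (In a' b' 3 Bot)"
  define x1 where "x1 = g1 (In a' b' 3 Bot)"
  note I = i[unfolded interpolable_def between_def]
  have p0: "upper_profile d g0" and p1: "upper_profile d g1" using I by auto
  note D0 = upper_profileD[OF p0] and D1 = upper_profileD[OF p1]
  have le01: "g0 q \<le> g1 q" "g1 q \<le> g0 q \<squnion> (a \<squnion> b)" if "pre_point d q" for q using I that by auto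
  have x01: "x0 \<le> x1" "x1 \<le> x0 \<squnion> (a \<squnion> b)"
    unfolding x0_def x1_def by (rule le01; simp add: d)+
  have h0: "g0 Top \<le> x0" "x0 \<le> g0 Bot" "x0 \<le> g0 Top \<squnion> a'" "g0 Bot \<le> x0 \<squnion> b'"
    and h1: "g1 Top \<le> x1" "x1 \<le> g1 Bot" "x1 \<le> g1 Top \<squnion> a'" "g1 Bot \<le> x1 \<squnion> b'"
    using upper_profileD(1,2)[OF D0(7)[OF d]] upper_profileD(1,2)[OF D0(8)[OF d]]
      upper_profileD(1,2)[OF D1(7)[OF d]] upper_profileD(1,2)[OF D1(8)[OF d]]
      D0(4-6)[OF d] D1(4-6)[OF d] by (simp_all add: x0_def x1_def)
  have *: "\<exists>x. (\<forall>l \<in> {t, x0}. l \<le> x) \<and> (\<forall>u \<in> {s, t \<squnion> a', x1, x0 \<squnion> a}. x \<le> u) \<and>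
      s \<le> x \<squnion> b' \<and> x1 \<le> x \<squnion> b"
  proof (rule interpolation[OF dist])
    have t: "g0 Top \<le> t" "t \<le> g1 Top" "t \<le> g0 Top \<squnion> a" "g1 Top \<le> t \<squnion> b"
      and s: "g0 Bot \<le> s" "s \<le> g1 Bot" "s \<le> g0 Bot \<squnion> a" "g1 Bot \<le> s \<squnion> b"
      and ts: "t \<le> s" "s \<le> t \<squnion> (a' \<squnion> b')" using I d by auto
    have "t \<le> x1" "x0 \<le> s" using t(2) h1(1) h0(2) s(1) by auto
    moreover have "t \<le> x0 \<squnion> a" "x0 \<le> t \<squnion> a'"
      using order_trans[OF t(3) sup_mono[OF h0(1) order_refl]]
        order_trans[OF h0(3) sup_mono[OF t(1) order_refl]] by auto
    ultimately show "l \<le> v" if "l \<in> {t, x0}" "v \<in> {s, t \<squnion> a', x1, x0 \<squnion> a}" for l v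
      using that ts(1) x01(1) by auto
    have "s \<le> x1 \<squnion> b'" "s \<le> x0 \<squnion> a \<squnion> b'"
      using order_trans[OF s(2) h1(4)] order_trans[OF s(3) sup_mono[OF h0(4) order_refl]]
      by (simp_all add: ac_simps)
    then show "s \<le> v \<squnion> b'" if "v \<in> {s, t \<squnion> a', x1, x0 \<squnion> a}" for v
      using that ts(2) by (auto simp: sup.assoc)
    have "x1 \<le> s \<squnion> b" "x1 \<le> t \<squnion> a' \<squnion> b"
      using order_trans[OF h1(2) s(4)] order_trans[OF h1(3) sup_mono[OF t(4) order_refl]]
      by (simp_all add: ac_simps)
    then show "x1 \<le> v \<squnion> b" if "v \<in> {s, t \<squnion> a', x1, x0 \<squnion> a}" for v
      using that x01(2) by (auto simp: sup.assoc)
  qed auto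
  then have "\<exists>x. between a' b' t s x \<and> between a b x0 x1 x" by (auto simp: between_def)
  then have x: "between a' b' t s x \<and> between a b x0 x1 x"
    unfolding x node_value_def x0_def x1_def by (rule someI_ex)
  have sub: "pre_point d (In a' b' 2 q)" if "pre_point b' q" for q using that d by (simp add: link_def)
  have sub': "pre_point d (In a' b' 3 q)" if "pre_point a' q" for q using that d by (simp add: link_def)
  show "interpolable a b b' (\<lambda>q. g0 (In a' b' 2 q)) (\<lambda>q. g1 (In a' b' 2 q)) s x"
    using D0(7)[OF d] D1(7)[OF d] le01[OF sub] x I D0(4,5)[OF d] D1(4,5)[OF d]
    by (auto simp: interpolable_def between_def x0_def x1_def)
  show "interpolable a b a' (\<lambda>q. g0 (In a' b' 3 q)) (\<lambda>q. g1 (In a' b' 3 q)) x t"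
    using D0(8)[OF d] D1(8)[OF d] le01[OF sub'] x I D0(6)[OF d] D1(6)[OF d]
    by (auto simp: interpolable_def between_def x0_def x1_def)
qed

text \<open>
  Being \<open>interpolable\<close> is inherited by the two links of the upper half, so it can serve as the
  invariant of the coinduction.
\<close>

lemma upper_profile_interpolant:
  fixes a b d :: "'a::bounded_semilattice_sup_bot"
  assumes dist: "distributive_semilattice TYPE('a)"
    and i: "interpolable a b d g0 g1 s t"
  shows "upper_profile d (interpolant a b g0 g1 s t)"
  using i
proof (coinduction arbitrary: d g0 g1 s t)
  case upper_profile
  then have i: "interpolable a b d g0 g1 s t" .
  let ?f = "interpolant a b g0 g1 s t"
  let ?P = "\<lambda>d h. \<exists>d' g0 g1 s t. d = d' \<and> h = interpolant a b g0 g1 s t \<and> interpolable a b d' g0 g1 s t"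
  have "(\<forall>k q. k < 2 \<longrightarrow> ?f (In a' b' k q) = ?f Bot) \<and> ?f (In a' b' 2 Bot) = ?f Bot \<and>
      ?f (In a' b' 2 Top) = ?f (In a' b' 3 Bot) \<and> ?f (In a' b' 3 Top) = ?f Top \<and>
      ?P b' (\<lambda>q. ?f (In a' b' 2 q)) \<and> ?P a' (\<lambda>q. ?f (In a' b' 3 q))"
    if d: "a' \<squnion> b' = d" for a' b'
  proof -
    note step = interpolable_step[OF dist i d refl]
    have "?P b' (\<lambda>q. ?f (In a' b' 2 q))"
      by (intro exI conjI, rule refl, simp, rule step(1))
    moreover have "?P a' (\<lambda>q. ?f (In a' b' 3 q))"
      by (intro exI conjI, rule refl, simp, rule step(2))
    ultimately show ?thesis by simp
  qed
  moreover have "?f Top \<le> ?f Bot" "?f Bot \<le> ?f Top \<squnion> d" using i by (auto simp: interpolable_def)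
  ultimately show ?case by (intro exI[of _ ?f] exI[of _ d]) blast
qed

lemma between_interpolant:
  fixes a b d :: "'a::bounded_semilattice_sup_bot"
  assumes dist: "distributive_semilattice TYPE('a)"
  shows "interpolable a b d g0 g1 s t \<Longrightarrow> pre_point d q \<Longrightarrow>
    between a b (g0 q) (g1 q) (interpolant a b g0 g1 s t q)"
proof (induction q arbitrary: d g0 g1 s t)
  case (In a' b' k q)
  have d: "a' \<squnion> b' = d" "k < 4" "pre_point (link a' b' k) q" using In.prems(2) by auto
  note step = interpolable_step[OF dist In.prems(1) d(1) refl]
  have p: "upper_profile d g0" "upper_profile d g1" using In.prems(1) by (auto simp: interpolable_def)
  consider "k < 2" | "k = 2" | "k = 3" using d(2) by linarith
  then show ?case
  proof cases
    case 1
    then show ?thesis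
      using In.prems(1) p[THEN upper_profileD(3), OF d(1)]
      by (simp add: interpolable_def)
  qed (use d(3) In.IH[OF step(1)] In.IH[OF step(2)] in \<open>simp_all add: link_def\<close>)
qed (auto simp: interpolable_def)

section \<open>The p-measure on one interval\<close>

text \<open>
  Given the profiles \<open>g0\<close> and \<open>g1\<close> of the two ends of an interval, the profile of its point \<open>p\<close>. It
  is \<open>g1\<close> when \<open>p\<close> lies in an upper half. The value \<open>g0 Bot \<squnion> a\<close> at \<open>Bot\<close> is not left to choice, since gaps to \<open>Bot\<close>
  must add up along the chain of \<open>p\<close>; and the gap to \<open>Top\<close> must vanish.
\<close>

fun spread :: "('a::bounded_semilattice_sup_bot pt \<Rightarrow> 'a) \<Rightarrow> ('a pt \<Rightarrow> 'a) \<Rightarrow> 'a pt \<Rightarrow> 'a pt \<Rightarrow> 'a" where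
  "spread g0 g1 Bot = g0"
| "spread g0 g1 Top = g1"
| "spread g0 g1 (In a b k p) =
    (let h = interpolant a b g0 g1 (g0 Bot \<squnion> a) bot
     in if k = 0 then spread g0 h p else if k = 1 then spread h g1 p else g1)"

text \<open>
  The invariant for the two ends of a link of gap \<open>c\<close> under the recursion of \<open>spread\<close>. The points \<open>q\<close> vary
  in an interval of gap \<open>d\<close>; on the outermost level \<open>d = c\<close>, but \<open>c\<close> shrinks during the recursion while
  \<open>d\<close> stays.
\<close>

definition profile_pair :: "'a::bounded_semilattice_sup_bot \<Rightarrow> 'a \<Rightarrow> ('a pt \<Rightarrow> 'a) \<Rightarrow> ('a pt \<Rightarrow> 'a) \<Rightarrow> bool"
  where "profile_pair c d g0 g1 \<longleftrightarrow> upper_profile d g0 \<and> upper_profile d g1 \<and>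
    g0 Top = bot \<and> g1 Top = bot \<and> g1 Bot = g0 Bot \<squnion> c \<and>
    (\<forall>q. pre_point d q \<longrightarrow> g0 q \<le> g1 q \<and> g1 q \<le> g0 q \<squnion> c)"

lemma profile_pair_split:
  fixes a b c d :: "'a::bounded_semilattice_sup_bot"
  assumes dist: "distributive_semilattice TYPE('a)"
    and p: "profile_pair c d g0 g1" and c: "a \<squnion> b = c"
    and h: "h = interpolant a b g0 g1 (g0 Bot \<squnion> a) bot"
  shows "profile_pair a d g0 h" "profile_pair b d h g1"
proof -
  note P = p[unfolded profile_pair_def]
  have "g1 Bot \<le> d" using upper_profileD(2)[of d g1] P by simp
  then have i: "interpolable a b d g0 g1 (g0 Bot \<squnion> a) bot"
    using P c by (auto simp: interpolable_def between_def le_supI1 le_supI2)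
  have "upper_profile d h" unfolding h by (rule upper_profile_interpolant[OF dist i])
  moreover have "h Bot = g0 Bot \<squnion> a" "h Top = bot" by (simp_all add: h)
  moreover have "between a b (g0 q) (g1 q) (h q)" if "pre_point d q" for q
    unfolding h by (rule between_interpolant[OF dist i that])
  ultimately show "profile_pair a d g0 h" "profile_pair b d h g1"
    using P c by (auto simp: profile_pair_def between_def sup.assoc intro: le_supI2)
qed

text \<open>
  Each step of the recursion replaces one of the two profiles by one between them. The gaps
  \<open>a\<close>, \<open>b\<close> of the links passed on the way up to \<open>p\<close> add up to \<open>above_bot c p\<close>.
\<close>

lemma spread_bounds:
  fixes c d :: "'a::bounded_semilattice_sup_bot"
  assumes dist: "distributive_semilattice TYPE('a)"
  shows "profile_pair c d g0 g1 \<Longrightarrow> pre_point c p \<Longrightarrow>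
    upper_profile d (spread g0 g1 p) \<and> spread g0 g1 p Bot = g0 Bot \<squnion> above_bot c p \<and>
    (\<forall>q. pre_point d q \<longrightarrow> g0 q \<le> spread g0 g1 p q \<and> spread g0 g1 p q \<le> g1 q \<and>
       spread g0 g1 p q \<le> g0 q \<squnion> above_bot c p)"
proof (induction p arbitrary: c g0 g1)
  case (In a b k p)
  define h where h: "h = interpolant a b g0 g1 (g0 Bot \<squnion> a) bot"
  have c: "a \<squnion> b = c" "k < 4" "pre_point (link a b k) p" using In.prems(2) by auto
  note S = profile_pair_split[OF dist In.prems(1) c(1) h]
  have hB: "h Bot = g0 Bot \<squnion> a" by (simp add: h)
  have b0: "g0 q \<le> h q \<and> h q \<le> g1 q \<and> h q \<le> g0 q \<squnion> a" if "pre_point d q" for q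
    using S that by (auto simp: profile_pair_def)
  consider "k = 0" | "k = 1" | "k \<ge> 2" by linarith
  then show ?case
  proof cases
    case 1
    then have "pre_point a p" using c by (simp add: link_def)
    then show ?thesis using In.IH[OF S(1)] b0 1 by (auto simp: h[symmetric] intro: order_trans)
  next
    case 2
    then have "pre_point b p" using c by (simp add: link_def)
    note IH = In.IH[OF S(2) this]
    have "spread h g1 p q \<le> g0 q \<squnion> (a \<squnion> above_bot b p)" if "pre_point d q" for q
    proof -
      have "spread h g1 p q \<le> h q \<squnion> above_bot b p" using IH that by auto
      also have "\<dots> \<le> g0 q \<squnion> a \<squnion> above_bot b p" using b0[OF that] by (intro sup_mono) auto
      finally show ?thesis by (simp add: sup.assoc)
    qed
    then show ?thesis using IH b0 2
      by (auto simp: h[symmetric] hB sup.assoc Let_def intro: order_trans)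
  next
    case 3
    then show ?thesis using In.prems(1) by (auto simp: profile_pair_def)
  qed
qed (auto simp: profile_pair_def)

text \<open>
  Different chains of the interval see each other through \<open>spread\<close>, started with the profiles \<open>0\<close> of
  \<open>Bot\<close> and \<open>below_top c\<close> of \<open>Top\<close>. On one chain, gaps add up from \<open>p\<close> down to \<open>q\<close>. Whole links strictly
  between them exist if \<open>k' + 1 < k\<close>; these are inner links, so they contribute \<open>b\<close>.
\<close>

fun gap :: "'a::bounded_semilattice_sup_bot \<Rightarrow> 'a pt \<Rightarrow> 'a pt \<Rightarrow> 'a" where
  "gap c Bot q = bot"
| "gap c p Top = bot"
| "gap c p Bot = above_bot c p"
| "gap c Top q = below_top c q"
| "gap c (In a b k p) (In a' b' k' q) =
    (if (a, b) = (a', b') then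
       if k < k' then bot
       else if k = k' then gap (link a b k) p q
       else above_bot (link a b k) p \<squnion> (if Suc k' < k then b else bot) \<squnion> below_top (link a b k') q
     else spread (\<lambda>_. bot) (below_top c) (In a b k p) (In a' b' k' q))"

lemma gap_from_Bot: "gap c Bot q = bot"
  by (cases q) auto

lemma gap_to_Top: "gap c p Top = bot"
  by (cases p) auto

lemma gap_from_Top: "gap c Top q = below_top c q"
  by (cases q) auto

lemma gap_to_Bot: "gap c p Bot = above_bot c p"
  by (cases p) auto

lemma gap_parallel:
  "(a, b) \<noteq> (a', b') \<Longrightarrow> gap c (In a b k p) (In a' b' k' q) =
    spread (\<lambda>_. bot) (below_top c) (In a b k p) (In a' b' k' q)"
  by auto

lemma gap_ascending: "k < k' \<Longrightarrow> gap c (In a b k p) (In a b k' q) = bot"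
  by simp

lemma gap_same_link: "gap c (In a b k p) (In a b k q) = gap (link a b k) p q"
  by simp

lemma gap_descending: "k' < k \<Longrightarrow> gap c (In a b k p) (In a b k' q) =
    above_bot (link a b k) p \<squnion> (if Suc k' < k then b else bot) \<squnion> below_top (link a b k') q"
  by simp

lemmas gap_rules = gap_from_Bot gap_to_Top gap_from_Top gap_to_Bot gap_parallel gap_ascending
  gap_same_link gap_descending

declare gap.simps [simp del]

lemma spread_upper_half: "2 \<le> k \<Longrightarrow> spread g0 g1 (In a b k p) = g1"
  by simp

lemma profile_pair_initial: "profile_pair c c (\<lambda>_. bot) (below_top c)"
  using upper_profile_below_top[of c bot]
  by (auto simp: profile_pair_def upper_profile_const below_top_le)

lemma spread_below_top:
  fixes c :: "'a::bounded_semilattice_sup_bot"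
  assumes dist: "distributive_semilattice TYPE('a)" and "pre_point c p" "pre_point c q"
  shows "spread (\<lambda>_. bot) (below_top c) p q \<le> above_bot c p"
    and "spread (\<lambda>_. bot) (below_top c) p q \<le> below_top c q"
  using spread_bounds[OF dist profile_pair_initial assms(2)] assms(3) by auto

text \<open>
  A profile is constant on lower halves, and the value at \<open>Bot\<close> of the profile of \<open>p\<close> is \<open>above_bot c p\<close>.
\<close>

lemma spread_lower_half:
  fixes c :: "'a::bounded_semilattice_sup_bot"
  assumes dist: "distributive_semilattice TYPE('a)" and "pre_point c p"
    and "pre_point c (In a b k q)" and "k < 2"
  shows "spread (\<lambda>_. bot) (below_top c) p (In a b k q) = above_bot c p"
  using spread_bounds[OF dist profile_pair_initial assms(2)] assms(3,4) by (auto dest: upper_profileD(3))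

text \<open>
  The triangle inequality through either end of the interval: \<open>\<parallel>p \<le> q\<parallel> \<le> \<parallel>p \<le> Bot\<parallel> \<squnion> \<parallel>Bot \<le> q\<parallel>\<close> and
  \<open>\<parallel>p \<le> q\<parallel> \<le> \<parallel>p \<le> Top\<parallel> \<squnion> \<parallel>Top \<le> q\<parallel>\<close>, where the gaps from \<open>Bot\<close> and to \<open>Top\<close> vanish.
\<close>

lemma gap_le:
  fixes c :: "'a::bounded_semilattice_sup_bot"
  assumes dist: "distributive_semilattice TYPE('a)"
  shows "pre_point c p \<Longrightarrow> pre_point c q \<Longrightarrow> gap c p q \<le> above_bot c p \<and> gap c p q \<le> below_top c q"
proof (induction c p q rule: gap.induct)
  case (5 c a b k p a' b' k' q)
  note pre = "5.prems"
  show ?case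
  proof (cases "(a, b) = (a', b')")
    case False
    then show ?thesis using spread_below_top[OF dist pre] unfolding gap_parallel[OF False] by blast
  next
    case True
    then have e: "a' = a" "b' = b" and c: "c = a \<squnion> b" using pre by auto
    have p: "pre_point (link a b k) p" "pre_point (link a b k') q" "k < 4" "k' < 4" using pre e by auto
    note le = above_bot_le[OF p(1)] below_top_le[OF p(1)] above_bot_le[OF p(2)] below_top_le[OF p(2)]
    consider "k < k'" | "k = k'" | "k > k'" by linarith
    then show ?thesis
    proof cases
      case 1
      then show ?thesis by (simp add: e gap_rules)
    next
      case 2
      with "5.IH" True p have "gap (link a b k) p q \<le> above_bot (link a b k) p"
        "gap (link a b k) p q \<le> below_top (link a b k) q" by auto
      then show ?thesis using 2 le p(3) e c
        by (auto simp: gap_rules link_def le_supI1 le_supI2 intro: order_trans)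
    next
      case 3
      then have "k \<in> {1, 2, 3}" "k' \<in> {0, 1, 2}" using p by auto
      then show ?thesis using 3 le e c
        by (auto simp: gap_rules link_def le_supI1 le_supI2)
    qed
  qed
qed (use above_bot_le below_top_le in \<open>auto simp: gap_rules simp del: above_bot.simps(3) below_top.simps(3) pre_point.simps(3)\<close>)

lemma profile_above_bot:
  assumes "upper_profile d g" and "pre_point d q"
  shows "g Bot \<le> g q \<squnion> above_bot d q"
proof (cases q)
  case (In a b k q')
  then have c: "a \<squnion> b = d" using assms(2) by simp
  show ?thesis
  proof (cases "k < 2")
    case True
    then show ?thesis using upper_profileD(3)[OF assms(1) c] In by simp
  next
    case False
    then show ?thesis
      using order_trans[OF upper_profileD(2)[OF assms(1)] sup_mono[OF conjunct1[OF upper_profile_bounds[OF assms]]]] In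
      by simp
  qed
qed (use upper_profileD[OF assms(1)] in auto)

lemma profile_below_top:
  "upper_profile d g \<Longrightarrow> pre_point d q \<Longrightarrow> g q \<le> g Top \<squnion> below_top d q"
proof (induction q arbitrary: d g)
  case (In a b k q)
  note D = upper_profileD[OF In.prems(1)]
  have c: "a \<squnion> b = d" "k < 4" "pre_point (link a b k) q" using In.prems(2) by auto
  consider "k < 2" | "k = 2" | "k = 3" using c(2) by linarith
  then show ?case
  proof cases
    case 1
    then show ?thesis using D(2) D(3)[OF c(1)] by simp
  next
    case 2
    have "g (In a b 2 q) \<le> g (In a b 3 Bot) \<squnion> below_top b q"
      using In.IH[OF D(7)[OF c(1)]] c(3) 2 D(5)[OF c(1)] by (simp add: link_def)
    also have "\<dots> \<le> g Top \<squnion> a \<squnion> below_top b q"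
      using upper_profileD(2)[OF D(8)[OF c(1)]] D(6)[OF c(1)] by (intro sup_mono) auto
    finally show ?thesis using 2 by (simp add: ac_simps)
  next
    case 3
    then show ?thesis
      using In.IH[OF D(8)[OF c(1)]] c(3) D(6)[OF c(1)] by (simp add: link_def)
  qed
qed (use upper_profileD in auto)

text \<open>
  The conditions on a profile are local, one for each link; this is their global consequence. Two
  points of the same chain are compared along the chain. For different chains, the gap
  is large enough unless the points lie in a lower and an upper half, and then \<open>g q2 \<le> g Bot = g q1\<close>.
\<close>

lemma profile_gap:
  fixes d :: "'a::bounded_semilattice_sup_bot"
  assumes dist: "distributive_semilattice TYPE('a)"
  shows "upper_profile d g \<Longrightarrow> pre_point d q1 \<Longrightarrow> pre_point d q2 \<Longrightarrow> g q2 \<le> g q1 \<squnion> gap d q1 q2"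
proof (induction q1 arbitrary: d g q2)
  case Bot
  then show ?case using upper_profile_bounds[of d g q2] by (simp add: gap_rules)
next
  case Top
  then show ?case using profile_below_top[of d g q2] by (simp add: gap_rules)
next
  case (In a b k q1 d g Q2)
  note p = In.prems(1)
  note D = upper_profileD[OF p]
  have c: "a \<squnion> b = d" "k < 4" "pre_point (link a b k) q1" using In.prems(2) by auto
  have B: "g Top \<le> g (In a b k q1)" using upper_profile_bounds[OF p In.prems(2)] by simp
  show ?case
  proof (cases Q2)
    case Q2: (In a2 b2 l q2)
    have c2: "a2 \<squnion> b2 = d" "l < 4" "pre_point (link a2 b2 l) q2" using In.prems(3) Q2 by auto
    have B2: "g Q2 \<le> g Bot" using upper_profile_bounds[OF p In.prems(3)] by simp
    show ?thesis
    proof (cases "(a2, b2) = (a, b)")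
      case False
      show ?thesis
      proof (cases "l < 2")
        case True
        then have "gap d (In a b k q1) Q2 = above_bot d (In a b k q1)"
          using False Q2 spread_lower_half[OF dist In.prems(2) In.prems(3)[unfolded Q2] True]
          by (subst Q2, subst gap_parallel) auto
        then show ?thesis
          using Q2 profile_above_bot[OF p In.prems(2)] D(3)[OF c2(1) True] by simp
      next
        case l: False
        show ?thesis
        proof (cases "k < 2")
          case True
          then show ?thesis using D(3)[OF c(1) True] B2 by (simp add: le_supI1)
        next
          case k: False
          have "gap d (In a b k q1) Q2 = below_top d Q2"
            using False k Q2 by (subst Q2, subst gap_parallel) (auto)
          then show ?thesis
            using order_trans[OF profile_below_top[OF p In.prems(3)] sup_mono[OF B order_refl]] by simp
        qed
      qed
    next
      case True
      then have e[simp]: "a2 = a" "b2 = b" by auto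
      note q2 = c2(3)[unfolded e]
      note pb = D(7)[OF c(1)] and pa = D(8)[OF c(1)]
      note E = D(4-6)[OF c(1)]
      have n3: "g (In a b 3 Bot) \<le> g (In a b 3 q1) \<squnion> above_bot a q1" if "k = 3"
        using profile_above_bot[OF pa] c(3) that by (simp add: link_def)
      consider "k < 2" | "k = l" "k \<ge> 2" | "k = 2" "l = 3" | "k = 2" "l < 2" | "k = 3" "l < 2" | "k = 3" "l = 2"
        using c(2) c2(2) by linarith
      then show ?thesis
      proof cases
        case 1
        then show ?thesis using D(3)[OF c(1) 1] B2 by (simp add: le_supI1)
      next
        case 2
        then have "k = 2 \<or> k = 3" using c(2) by linarith
        then show ?thesis using 2 In.IH[OF pa] In.IH[OF pb] c(3) q2 Q2
          by (auto simp: gap_rules link_def)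
      next
        case 3
        have "g (In a b 3 q2) \<le> g (In a b 3 Bot)"
          using upper_profile_bounds[OF pa, of q2] q2 3 by (simp add: link_def)
        also have "\<dots> \<le> g (In a b 2 q1)"
          using upper_profile_bounds[OF pb, of q1] c(3) 3 E by (simp add: link_def)
        finally show ?thesis using 3 Q2 by (simp add: le_supI1)
      next
        case 4
        have "g Bot \<le> g (In a b 2 q1) \<squnion> above_bot b q1"
          using profile_above_bot[OF pb, of q1] c(3) 4 E by (simp add: link_def)
        then show ?thesis using 4 Q2 D(3)[OF c2(1)]
          by (auto simp: gap_rules link_def le_supI1 sup.assoc[symmetric])
      next
        case 5
        have "g Bot \<le> g (In a b 3 Bot) \<squnion> b" using upper_profileD(2)[OF pb] E by simp
        also have "\<dots> \<le> g (In a b 3 q1) \<squnion> above_bot a q1 \<squnion> b" using n3 5 by (intro sup_mono) auto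
        finally show ?thesis using 5 Q2 D(3)[OF c2(1)]
          by (auto simp: gap_rules link_def le_supI1 sup.assoc[symmetric])
      next
        case 6
        have "g (In a b 2 q2) \<le> g (In a b 3 Bot) \<squnion> below_top b q2"
          using profile_below_top[OF pb, of q2] q2 6 E by (simp add: link_def)
        also have "\<dots> \<le> g (In a b 3 q1) \<squnion> above_bot a q1 \<squnion> below_top b q2"
          using n3 6 by (intro sup_mono) auto
        finally show ?thesis using 6 Q2
          by (auto simp: gap_rules link_def sup.assoc)
      qed
    qed
  qed (use profile_above_bot[OF p In.prems(2)] B in \<open>simp_all add: gap_rules\<close>)
qed

lemma spread_below:
  fixes c d :: "'a::bounded_semilattice_sup_bot"
  assumes dist: "distributive_semilattice TYPE('a)"
    and pp: "profile_pair c d g0 g1" and p: "pre_point c p" and q: "pre_point d q"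
  shows "g1 q \<le> spread g0 g1 p q \<squnion> below_top c p"
proof -
  have c: "g1 q \<le> spread g0 g1 p q \<squnion> c"
    using spread_bounds[OF dist pp p] pp q unfolding profile_pair_def
    by (meson order_refl order_trans sup_mono)
  show ?thesis
  proof (cases p)
    case (In a b k p')
    then show ?thesis using c by (cases "k < 2") auto
  qed (use c in auto)
qed

text \<open>
  The companion of \<open>profile_gap\<close> in the other variable. The point \<open>q\<close> stays fixed, so the
  proof only follows the recursion of \<open>spread\<close> and uses how its values at the ends of
  a link are related.
\<close>

lemma spread_gap:
  fixes c d :: "'a::bounded_semilattice_sup_bot"
  assumes dist: "distributive_semilattice TYPE('a)"
  shows "profile_pair c d g0 g1 \<Longrightarrow> pre_point c p1 \<Longrightarrow> pre_point c p2 \<Longrightarrow> pre_point d q \<Longrightarrow>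
    spread g0 g1 p1 q \<le> gap c p1 p2 \<squnion> spread g0 g1 p2 q"
proof (induction p1 arbitrary: c g0 g1 p2)
  case Bot
  then show ?case using spread_bounds[OF dist Bot(1,3)] by (simp add: gap_rules)
next
  case Top
  then show ?case using spread_below[OF dist Top(1,3,4)] by (simp add: gap_rules sup.commute)
next
  case (In a b k p1 c g0 g1 P2)
  note pp = In.prems(1) and q = In.prems(4)
  note S1 = spread_bounds[OF dist pp In.prems(2)] and S2 = spread_bounds[OF dist pp In.prems(3)]
  have c: "a \<squnion> b = c" "k < 4" "pre_point (link a b k) p1" using In.prems(2) by auto
  show ?case
  proof (cases P2)
    case P2: (In a2 b2 l p2)
    show ?thesis
    proof (cases "l < 2")
      case False
      then show ?thesis using S1 q P2 by (auto simp: spread_upper_half intro: le_supI2)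
    next
      case l: True
      show ?thesis
      proof (cases "(a2, b2) = (a, b)")
        case False
        then have "gap c (In a b k p1) P2 = above_bot c (In a b k p1)"
          using P2 spread_lower_half[OF dist In.prems(2) In.prems(3)[unfolded P2] l]
          by (subst P2, subst gap_parallel) auto
        then have "spread g0 g1 (In a b k p1) q \<le> g0 q \<squnion> gap c (In a b k p1) P2"
          using S1 q by simp
        also have "\<dots> \<le> spread g0 g1 P2 q \<squnion> gap c (In a b k p1) P2"
          using S2 q by (intro sup_mono) auto
        finally show ?thesis by (simp add: sup.commute)
      next
        case True
        then have e[simp]: "a2 = a" "b2 = b" by auto
        have p2: "pre_point (link a b l) p2" using In.prems(3) P2 by simp
        define h where h: "h = interpolant a b g0 g1 (g0 Bot \<squnion> a) bot"
        note S = profile_pair_split[OF dist pp c(1) h]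
        have sp: "spread g0 g1 (In a b 0 p) = spread g0 h p" "spread g0 g1 (In a b (Suc 0) p) = spread h g1 p" for p
          by (simp_all add: h)
        have hq: "g1 q \<le> h q \<squnion> b" "h q \<le> g1 q" using S q by (auto simp: profile_pair_def)
        have low: "h q \<le> spread g0 h p2 q \<squnion> below_top a p2" if "l = 0"
          using spread_below[OF dist S(1) _ q] p2 that by (simp add: link_def)
        have up: "g1 q \<le> spread h g1 p2 q \<squnion> below_top b p2" "h q \<le> spread h g1 p2 q" if "l = 1"
          using spread_below[OF dist S(2) _ q] spread_bounds[OF dist S(2)] p2 q that
          by (auto simp: link_def)
        have low1: "spread g0 h p1 q \<le> h q" if "k = 0"
          using spread_bounds[OF dist S(1)] c(3) q that by (simp add: link_def)
        have up1: "spread h g1 p1 q \<le> h q \<squnion> above_bot b p1" if "k = 1"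
          using spread_bounds[OF dist S(2)] c(3) q that by (simp add: link_def)
        consider "k = 0" "l = 0" | "k = 1" "l = 1" | "k = 0" "l = 1" | "k = 1" "l = 0"
          | "k \<ge> 2" "l = 0" | "k \<ge> 2" "l = 1"
          using l by linarith
        then show ?thesis
        proof cases
          case 1
          then show ?thesis using In.IH[OF S(1) _ _ q] c(3) p2 P2
            by (simp add: sp gap_rules link_def del: spread.simps)
        next
          case 2
          then show ?thesis using In.IH[OF S(2) _ _ q] c(3) p2 P2
            by (simp add: sp gap_rules link_def del: spread.simps)
        next
          case 3
          then show ?thesis using low1 up P2
            by (auto simp: sp simp del: spread.simps intro: order_trans le_supI2)
        next
          case 4
          have "spread h g1 p1 q \<le> (spread g0 h p2 q \<squnion> below_top a p2) \<squnion> above_bot b p1"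
            using order_trans[OF up1 sup_mono[OF low order_refl]] 4 by simp
          then show ?thesis using 4 P2
            by (simp add: sp gap_rules link_def ac_simps del: spread.simps)
        next
          case 5
          have "g1 q \<le> (spread g0 h p2 q \<squnion> below_top a p2) \<squnion> b"
            using order_trans[OF hq(1) sup_mono[OF low order_refl]] 5 by simp
          then have "g1 q \<le> above_bot (link a b k) p1 \<squnion> ((spread g0 h p2 q \<squnion> below_top a p2) \<squnion> b)"
            by (rule le_supI2)
          then show ?thesis using 5 P2
            by (simp add: spread_upper_half sp gap_rules link_def ac_simps del: spread.simps)
        next
          case 6
          have "g1 q \<le> (above_bot (link a b k) p1 \<squnion> (if Suc 1 < k then b else bot)) \<squnion> (spread h g1 p2 q \<squnion> below_top b p2)"
            using up 6 by (auto intro: le_supI2)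
          then show ?thesis using 6 P2
            by (simp add: spread_upper_half sp gap_rules link_def ac_simps del: spread.simps)
        qed
      qed
    qed
  next
    case Bot
    then show ?thesis using S1 q by (simp add: gap_rules sup.commute del: spread.simps(3) above_bot.simps)
  next
    case Top
    then show ?thesis using S1 q by (auto intro: le_supI2 simp del: spread.simps(3))
  qed
qed

lemma above_bot_gap:
  fixes c :: "'a::bounded_semilattice_sup_bot"
  assumes dist: "distributive_semilattice TYPE('a)" and "pre_point c p" "pre_point c q"
  shows "above_bot c p \<le> gap c p q \<squnion> above_bot c q"
  using spread_gap[OF dist profile_pair_initial assms(2,3), of Bot]
    spread_bounds[OF dist profile_pair_initial] assms(2,3) by simp

lemma below_top_gap:
  fixes c :: "'a::bounded_semilattice_sup_bot"
  assumes dist: "distributive_semilattice TYPE('a)" and "pre_point c p" "pre_point c q"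
  shows "below_top c q \<le> below_top c p \<squnion> gap c p q"
  using profile_gap[OF dist _ assms(2,3)] upper_profile_below_top[of c bot] by simp

text \<open>
  If all points lie on one chain, gaps add up. If exactly \<open>p\<close> and \<open>q\<close>, or exactly \<open>q\<close> and \<open>r\<close>, share
  a chain, the inequality is \<open>spread_gap\<close> or \<open>profile_gap\<close>. If \<open>q\<close> is on a chain different from those
  of \<open>p\<close> and \<open>r\<close>, then \<open>\<parallel>p \<le> q\<parallel> = \<parallel>p \<le> Bot\<parallel>\<close> for \<open>q\<close> in a lower half and \<open>\<parallel>q \<le> r\<parallel> = \<parallel>Top \<le> r\<parallel>\<close> for \<open>q\<close> in an
  upper half, and either bounds \<open>\<parallel>p \<le> r\<parallel>\<close>.
\<close>

lemma gap_triangle: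
  fixes c :: "'a::bounded_semilattice_sup_bot"
  assumes dist: "distributive_semilattice TYPE('a)"
  shows "pre_point c p \<Longrightarrow> pre_point c q \<Longrightarrow> pre_point c r \<Longrightarrow> gap c p r \<le> gap c p q \<squnion> gap c q r"
proof (induction p arbitrary: c q r)
  case (In a b k p c Q R)
  have "gap c (In a b k p) (In a2 b2 n r) \<le> gap c (In a b k p) (In a1 b1 l q) \<squnion> gap c (In a1 b1 l q) (In a2 b2 n r)"
    if Q: "Q = In a1 b1 l q" and R: "R = In a2 b2 n r" for a1 b1 l q a2 b2 n r
  proof -
    note pre = In.prems[unfolded Q R]
    have c: "c = a \<squnion> b" using pre by auto
    have p: "pre_point (link a b k) p" "pre_point (link a1 b1 l) q" "pre_point (link a2 b2 n) r"
      "k < 4" "l < 4" "n < 4" using pre by auto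
    note gPR = gap_le[OF dist pre(1,3)]
    show ?thesis
    proof (cases "(a1, b1) = (a, b)")
      case True
      then have e1[simp]: "a1 = a" "b1 = b" by auto
      show ?thesis
      proof (cases "(a2, b2) = (a, b)")
        case True
        then have e2[simp]: "a2 = a" "b2 = b" by auto
        note p' = p[unfolded e1 e2]
        note IH = In.IH[OF p'(1)]
        have le: "above_bot (link a b k) p \<le> link a b k" "below_top (link a b n) r \<le> link a b n"
          using above_bot_le below_top_le p' by blast+
        consider "k < n" | "k = n" "l = n" | "k = n" "l < n" | "k = n" "l > n" | "k > n" "l > k" | "k > n" "l = k"
          | "k > n" "l = n" | "k > n" "l < n" | "k > n" "k > l" "l > n"
          using linorder_less_linear[of k n] linorder_less_linear[of l n] linorder_less_linear[of l k] by blast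
        then show ?thesis
        proof cases
          case 1 then show ?thesis by (simp add: gap_rules)
        next
          case 2 then show ?thesis using IH p' by (simp add: gap_rules)
        next
          case 3
          have "gap (link a b k) p r \<le> above_bot (link a b k) p"
            using gap_le[OF dist p'(1)] p' 3 by simp
          then show ?thesis using 3 by (simp add: gap_rules le_supI1 le_supI2)
        next
          case 4
          have "gap (link a b k) p r \<le> below_top (link a b n) r"
            using gap_le[OF dist p'(1)] p' 4 by simp
          then show ?thesis using 4 by (simp add: gap_rules le_supI1 le_supI2)
        next
          case 5
          then have "link a b k = b" "Suc n < l" using p' by (auto simp: link_def)
          then show ?thesis using 5 le by (auto simp: gap_rules le_supI1 le_supI2)
        next
          case 6
          have "above_bot (link a b k) p \<le> gap (link a b k) p q \<squnion> above_bot (link a b k) q"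
            using above_bot_gap[OF dist p'(1)] p' 6 by simp
          then have "above_bot (link a b k) p \<le> gap (link a b k) p q \<squnion> (above_bot (link a b k) q \<squnion>
              (if Suc n < k then b else bot) \<squnion> below_top (link a b n) r)"
            by (rule order_trans) (simp add: le_supI1 le_supI2)
          then show ?thesis using 6 by (auto simp: gap_rules ac_simps le_supI1 le_supI2)
        next
          case 7
          have "below_top (link a b n) r \<le> below_top (link a b n) q \<squnion> gap (link a b n) q r"
            using below_top_gap[OF dist _ p'(3)] p' 7 by simp
          then show ?thesis using 7 by (auto simp: gap_rules ac_simps le_supI1 le_supI2)
        next
          case 8
          then have "link a b n = b" "Suc l < k" using p' by (auto simp: link_def)
          then show ?thesis using 8 le by (auto simp: gap_rules le_supI1 le_supI2)
        next
          case 9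
          then have l: "link a b l = b" using p' by (auto simp: link_def)
          then have "b \<le> below_top b q \<squnion> above_bot b q"
            using le_above_below[of b q] by (simp add: ac_simps)
          then have "b \<le> below_top b q \<squnion> above_bot b q \<squnion>
              (above_bot (link a b k) p \<squnion> below_top (link a b n) r)" by (rule le_supI1)
          then show ?thesis using 9 l by (auto simp: gap_rules ac_simps le_supI1 le_supI2)
        qed
      next
        case False
        then show ?thesis
          using spread_gap[OF dist profile_pair_initial pre]
          by (auto simp: gap_parallel simp del: spread.simps)
      qed
    next
      case ne: False
      show ?thesis
      proof (cases "(a2, b2) = (a1, b1)")
        case True
        then show ?thesis
          using ne profile_gap[OF dist conjunct1[OF spread_bounds[OF dist profile_pair_initial pre(1)]] pre(2,3)]
          by (auto simp: gap_parallel simp del: spread.simps)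
      next
        case False
        show ?thesis
        proof (cases "l < 2")
          case True
          then show ?thesis using spread_lower_half[OF dist pre(1,2) True] ne gPR
            by (auto simp: gap_parallel simp del: spread.simps above_bot.simps below_top.simps intro: le_supI1)
        next
          case False
          then have "gap c (In a1 b1 l q) (In a2 b2 n r) = below_top c (In a2 b2 n r)"
            using \<open>(a2, b2) \<noteq> (a1, b1)\<close> by (subst gap_parallel) (auto simp: spread_upper_half)
          then show ?thesis using gPR by (simp add: le_supI2 del: below_top.simps)
        qed
      qed
    qed
  qed
  then show ?case
    using above_bot_gap[OF dist In.prems(1,2)] gap_le[OF dist In.prems(1,3)]
    by (cases Q; cases R)
      (auto simp: gap_from_Bot gap_from_Top gap_to_Bot gap_to_Top simp del: above_bot.simps below_top.simps)
next
  case (Top c q r)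
  then show ?case using below_top_gap[OF dist Top(2,3)] by (simp add: gap_rules)
qed (simp add: gap_rules)

section \<open>The order on one interval\<close>

fun pt_le :: "'a pt \<Rightarrow> 'a pt \<Rightarrow> bool" where
  "pt_le Bot q = True"
| "pt_le p Top = True"
| "pt_le (In a b k p) (In a' b' k' q) = (a = a' \<and> b = b' \<and> (k < k' \<or> k = k' \<and> pt_le p q))"
| "pt_le _ _ = False"

text \<open>
  Unique names: the upper end of a link is named as the next node or as \<open>Top\<close>, and the lower end of
  the first link as \<open>Bot\<close>. The parts of a decomposition are nonzero, as required for condition (i).
\<close>

fun point :: "'a::bounded_semilattice_sup_bot \<Rightarrow> 'a pt \<Rightarrow> bool" where
  "point c Bot = True"
| "point c Top = True"
| "point c (In a b k p) = (a \<squnion> b = c \<and> a \<noteq> bot \<and> b \<noteq> bot \<and> k < 4 \<and> p \<noteq> Top \<and>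
     (k = 0 \<longrightarrow> p \<noteq> Bot) \<and> point (link a b k) p)"

lemma point_imp_pre_point: "point c p \<Longrightarrow> pre_point c p"
  by (induction p arbitrary: c) auto

lemma pt_le_refl: "pt_le p p"
  by (induction p) auto

lemma pt_le_to_Bot: "pt_le p Bot \<longleftrightarrow> p = Bot"
  by (cases p) auto

lemma pt_le_to_Top: "pt_le p Top"
  by (cases p) auto

lemma pt_le_from_Top: "pt_le Top p \<longleftrightarrow> p = Top"
  by (cases p) auto

lemma pt_le_antisym: "pt_le p q \<Longrightarrow> pt_le q p \<Longrightarrow> p = q"
  by (induction p q rule: pt_le.induct) (auto simp: pt_le_to_Bot pt_le_from_Top)

lemma pt_le_trans: "pt_le p q \<Longrightarrow> pt_le q r \<Longrightarrow> pt_le p r"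
proof (induction p arbitrary: q r)
  case (In a b k p)
  then show ?case by (cases q; cases r) auto
qed (auto simp: pt_le_from_Top)

text \<open>
  The inclusion of the interval that fills link \<open>k\<close>; it sends the ends of the link to their unique
  names.
\<close>

fun into_link :: "'a \<Rightarrow> 'a \<Rightarrow> nat \<Rightarrow> 'a pt \<Rightarrow> 'a pt" where
  "into_link a b k Bot = (if k = 0 then Bot else In a b k Bot)"
| "into_link a b k Top = (if k = 3 then Top else In a b (Suc k) Bot)"
| "into_link a b k p = In a b k p"

lemma into_link_eq_In: "point c (In a b k p) \<Longrightarrow> into_link a b k p = In a b k p"
  by (cases p) auto

lemma point_into_link:
  assumes "a \<squnion> b = c" "a \<noteq> bot" "b \<noteq> bot" "k < 4" "point (link a b k) p"
  shows "point c (into_link a b k p)"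
  using assms by (cases p) auto

lemma into_link_mono: "k < 4 \<Longrightarrow> pt_le p q \<Longrightarrow> pt_le (into_link a b k p) (into_link a b k q)"
  by (cases p; cases q) auto

text \<open>
  Points of the same link have their meet there; its lower end may have to be renamed. Comparable
  points are trivial, and points on different chains have only \<open>Bot\<close> below them.
\<close>

lemma point_inf_exists:
  "point c p \<Longrightarrow> point c q \<Longrightarrow>
    \<exists>m. point c m \<and> (\<forall>r. point c r \<longrightarrow> (pt_le r m \<longleftrightarrow> pt_le r p \<and> pt_le r q))"
proof (induction p arbitrary: c q)
  case Bot
  then show ?case by (intro exI[of _ Bot]) (auto simp: pt_le_to_Bot)
next
  case Top
  then show ?case by (intro exI[of _ q]) (auto simp: pt_le_to_Top)
next
  case (In a b k p c Q)
  note P = In.prems(1)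
  show ?case
  proof (cases Q)
    case Bot
    then show ?thesis by (intro exI[of _ Bot]) (auto simp: pt_le_to_Bot)
  next
    case Top
    then show ?thesis using P by (intro exI[of _ "In a b k p"]) (auto simp: pt_le_to_Top)
  next
    case Q: (In a' b' k' q)
    have down: "pt_le r (In a b k p) \<Longrightarrow> pt_le (In a b k p) Q \<Longrightarrow> pt_le r Q"
      and down': "pt_le r Q \<Longrightarrow> pt_le Q (In a b k p) \<Longrightarrow> pt_le r (In a b k p)" for r
      by (rule pt_le_trans; assumption)+
    consider "(a', b') \<noteq> (a, b)" | "pt_le (In a b k p) Q" | "pt_le Q (In a b k p)"
      | "a' = a" "b' = b" "k' = k"
      using Q by fastforce
    then show ?thesis
    proof cases
      case 1
      have "\<not> (pt_le r (In a b k p) \<and> pt_le r Q)" if "r \<noteq> Bot" for r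
        using 1 Q that by (cases r) auto
      then show ?thesis by (intro exI[of _ Bot]) (auto simp: pt_le_to_Bot)
    next
      case 2
      then show ?thesis using P down by blast
    next
      case 3
      then show ?thesis using In.prems(2) down' by blast
    next
      case 4
      have v: "a \<squnion> b = c" "a \<noteq> bot" "b \<noteq> bot" "k < 4" "p \<noteq> Top" "q \<noteq> Top" "point (link a b k) p"
        "point (link a b k) q" using P In.prems(2) Q 4 by auto
      from In.IH[OF v(7,8)] obtain m where m: "point (link a b k) m"
        "\<And>r. point (link a b k) r \<Longrightarrow> pt_le r m \<longleftrightarrow> pt_le r p \<and> pt_le r q" by blast
      have nT: "m \<noteq> Top" using m(2)[OF m(1)] v(5) by (auto simp: pt_le_refl pt_le_from_Top)
      have "pt_le r (into_link a b k m) \<longleftrightarrow> pt_le r (In a b k p) \<and> pt_le r Q" if r: "point c r" for r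
      proof (cases r)
        case r: (In a3 b3 n r')
        have *: "pt_le r' m \<longleftrightarrow> pt_le r' p \<and> pt_le r' q" if "a3 = a" "b3 = b" "n = k"
          using m(2) \<open>point c r\<close> r that by simp
        show ?thesis
        proof (cases m)
          case Bot
          then show ?thesis using * r Q 4 \<open>point c r\<close> by (auto simp: pt_le_to_Bot)
        next
          case (In a4 b4 n' m')
          then show ?thesis using * r Q 4 by auto
        qed (use nT in simp)
      next
        case Top
        then show ?thesis using nT Q by (cases m) auto
      qed simp
      then show ?thesis using point_into_link[OF v(1-4) m(1)] by blast
    qed
  qed
qed

lemma point_sup_exists:
  "point c p \<Longrightarrow> point c q \<Longrightarrow>
    \<exists>m. point c m \<and> (\<forall>r. point c r \<longrightarrow> (pt_le m r \<longleftrightarrow> pt_le p r \<and> pt_le q r))"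
proof (induction p arbitrary: c q)
  case Bot
  then show ?case by (intro exI[of _ q]) auto
next
  case Top
  then show ?case by (intro exI[of _ Top]) (auto simp: pt_le_to_Top pt_le_from_Top)
next
  case (In a b k p c Q)
  note P = In.prems(1)
  show ?case
  proof (cases Q)
    case Bot
    then show ?thesis using P by (intro exI[of _ "In a b k p"]) auto
  next
    case Top
    then show ?thesis by (intro exI[of _ Top]) (auto simp: pt_le_to_Top pt_le_from_Top)
  next
    case Q: (In a' b' k' q)
    have up: "pt_le Q r \<Longrightarrow> pt_le (In a b k p) Q \<Longrightarrow> pt_le (In a b k p) r"
      and up': "pt_le (In a b k p) r \<Longrightarrow> pt_le Q (In a b k p) \<Longrightarrow> pt_le Q r" for r
      by (rule pt_le_trans; assumption)+
    consider "(a', b') \<noteq> (a, b)" | "pt_le (In a b k p) Q" | "pt_le Q (In a b k p)"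
      | "a' = a" "b' = b" "k' = k"
      using Q by fastforce
    then show ?thesis
    proof cases
      case 1
      have "\<not> (pt_le (In a b k p) r \<and> pt_le Q r)" if "r \<noteq> Top" for r
        using 1 Q that by (cases r) auto
      then show ?thesis by (intro exI[of _ Top]) (auto simp: pt_le_from_Top pt_le_to_Top)
    next
      case 2
      then show ?thesis using In.prems(2) up by blast
    next
      case 3
      then show ?thesis using P up' by blast
    next
      case 4
      have v: "a \<squnion> b = c" "a \<noteq> bot" "b \<noteq> bot" "k < 4" "k = 0 \<longrightarrow> p \<noteq> Bot" "point (link a b k) p"
        "point (link a b k) q" using P In.prems(2) Q 4 by auto
      from In.IH[OF v(6,7)] obtain m where m: "point (link a b k) m"
        "\<And>r. point (link a b k) r \<Longrightarrow> pt_le m r \<longleftrightarrow> pt_le p r \<and> pt_le q r" by blast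
      have nB: "k = 0 \<Longrightarrow> m \<noteq> Bot" using m(2)[OF m(1)] v(5) by (auto simp: pt_le_refl pt_le_to_Bot)
      have "pt_le (into_link a b k m) r \<longleftrightarrow> pt_le (In a b k p) r \<and> pt_le Q r" if r: "point c r" for r
      proof (cases r)
        case r: (In a3 b3 n r')
        have *: "pt_le m r' \<longleftrightarrow> pt_le p r' \<and> pt_le q r'" if "a3 = a" "b3 = b" "n = k"
          using m(2) \<open>point c r\<close> r that by simp
        show ?thesis
        proof (cases m)
          case Top
          then show ?thesis using * r Q 4 \<open>point c r\<close> v(4) by (auto simp: pt_le_from_Top)
        next
          case (In a4 b4 n' m')
          then show ?thesis using * r Q 4 by auto
        next
          case Bot
          then show ?thesis using * r Q 4 nB by auto
        qed
      next
        case Bot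
        then show ?thesis using nB v(4) by (cases m) auto
      qed (auto simp: pt_le_to_Top)
      then show ?thesis using point_into_link[OF v(1-4) m(1)] by blast
    qed
  qed
qed

lemma gap_eq_bot_if_le: "pt_le p q \<Longrightarrow> gap c p q = bot"
  by (induction p q arbitrary: c rule: pt_le.induct) (auto simp: gap_rules)

lemma above_bot_nonzero: "point c p \<Longrightarrow> p \<noteq> Bot \<Longrightarrow> c \<noteq> bot \<Longrightarrow> above_bot c p \<noteq> bot"
  by (induction p arbitrary: c) (auto simp: link_def)

lemma below_top_nonzero: "point c p \<Longrightarrow> p \<noteq> Top \<Longrightarrow> c \<noteq> bot \<Longrightarrow> below_top c p \<noteq> bot"
  by (induction p arbitrary: c) (auto simp: link_def)

lemma link_nonzero: "a \<noteq> bot \<Longrightarrow> b \<noteq> bot \<Longrightarrow> link a b k \<noteq> bot"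
  by (simp add: link_def)

lemma gap_nonzero:
  "point c p \<Longrightarrow> point c q \<Longrightarrow> c \<noteq> bot \<Longrightarrow> pt_le p q \<Longrightarrow> p \<noteq> q \<Longrightarrow> gap c q p \<noteq> bot"
proof (induction p q arbitrary: c rule: pt_le.induct)
  case (3 a b k p a' b' k' q)
  then show ?case
    using below_top_nonzero[of "link a b k" p] link_nonzero[of a b k]
    by (auto simp: gap_rules)
qed (use above_bot_nonzero below_top_nonzero in \<open>auto simp: gap_rules simp del: point.simps above_bot.simps below_top.simps\<close>)

text \<open>
  This includes the ends of the link, whose gaps are computed on the larger interval by different
  equations because of their new names. It allows fine paths to be carried into the larger interval.
\<close>

lemma gap_into_link:
  assumes "a \<squnion> b = c" "k < 4"
  shows "gap c (into_link a b k p) (into_link a b k q) = gap (link a b k) p q"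
proof -
  have "k = 0 \<or> k = 1 \<or> k = 2 \<or> k = 3" using assms(2) by linarith
  then show ?thesis using assms(1)
    by (cases p; cases q) (auto simp: gap_rules link_def)
qed

text \<open>
  Condition (ii) asks for paths of such steps.
\<close>

definition fine_step :: "'a::bounded_semilattice_sup_bot \<Rightarrow> 'a \<Rightarrow> 'a \<Rightarrow> 'a pt \<Rightarrow> 'a pt \<Rightarrow> bool" where
  "fine_step x y c p q \<longleftrightarrow> point c p \<and> point c q \<and> pt_le p q \<and> (gap c q p \<le> x \<or> gap c q p \<le> y)"

text \<open>
  Distributivity splits \<open>c\<close> into parts below \<open>x\<close> and \<open>y\<close>, and there is a chain for them. A summand may be zero, in which case the
  interval has no chain for the decomposition, but then the interval is a single step.
\<close>

lemma fine_path_whole: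
  fixes c :: "'a::bounded_semilattice_sup_bot"
  assumes dist: "distributive_semilattice TYPE('a)" and "c \<le> x \<squnion> y"
  shows "(fine_step x y c)\<^sup>*\<^sup>* Bot Top"
proof -
  obtain a b where ab: "a \<le> x" "b \<le> y" "c = a \<squnion> b"
    using assms unfolding distributive_semilattice_def by metis
  show ?thesis
  proof (cases "a = bot \<or> b = bot")
    case True
    then have "fine_step x y c Bot Top" using ab by (auto simp: fine_step_def gap_rules)
    then show ?thesis by blast
  next
    case False
    then have "fine_step x y c Bot (In a b 1 Bot)" "fine_step x y c (In a b 1 Bot) (In a b 2 Bot)"
      "fine_step x y c (In a b 2 Bot) (In a b 3 Bot)" "fine_step x y c (In a b 3 Bot) Top"
      using ab by (auto simp: fine_step_def gap_rules link_def)
    then show ?thesis by (meson r_into_rtranclp rtranclp_trans)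
  qed
qed

lemma fine_path_into_link:
  assumes "a \<squnion> b = c" "a \<noteq> bot" "b \<noteq> bot" "k < 4"
    and "(fine_step x y (link a b k))\<^sup>*\<^sup>* p q"
  shows "(fine_step x y c)\<^sup>*\<^sup>* (into_link a b k p) (into_link a b k q)"
  using assms(5)
proof (induction rule: rtranclp_induct)
  case (step q r)
  have "fine_step x y c (into_link a b k q) (into_link a b k r)"
    using step(2) point_into_link[OF assms(1-4)] into_link_mono[OF assms(4)] gap_into_link[OF assms(1,4)]
    by (auto simp: fine_step_def)
  then show ?case using step(3) by simp
qed simp

lemma fine_path_chain:
  fixes c :: "'a::bounded_semilattice_sup_bot"
  assumes dist: "distributive_semilattice TYPE('a)"
    and ab: "a \<squnion> b = c" "a \<noteq> bot" "b \<noteq> bot"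
    and "i \<le> k" "k < 4" "\<And>j. i \<le> j \<Longrightarrow> j < k \<Longrightarrow> link a b j \<le> x \<squnion> y"
  shows "(fine_step x y c)\<^sup>*\<^sup>* (into_link a b i Bot) (into_link a b k Bot)"
  using assms(5-7)
proof (induction k rule: dec_induct)
  case (step k)
  have "(fine_step x y c)\<^sup>*\<^sup>* (into_link a b k Bot) (into_link a b k Top)"
    using step by (intro fine_path_into_link[OF ab] fine_path_whole[OF dist]) auto
  then show ?case using step by simp
qed simp

lemma fine_path_from_Bot:
  fixes c :: "'a::bounded_semilattice_sup_bot"
  assumes dist: "distributive_semilattice TYPE('a)"
  shows "point c q \<Longrightarrow> above_bot c q \<le> x \<squnion> y \<Longrightarrow> (fine_step x y c)\<^sup>*\<^sup>* Bot q"
proof (induction q arbitrary: c)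
  case (In a b k q)
  have v: "a \<squnion> b = c" "a \<noteq> bot" "b \<noteq> bot" "k < 4" and q: "point (link a b k) q" using In.prems by auto
  have le: "link a b j \<le> x \<squnion> y" if "j < k" for j
    using In.prems(2) v(1) that by (auto simp: link_def split: if_splits)
  have "above_bot (link a b k) q \<le> x \<squnion> y"
    using In.prems(2) v(1,4) above_bot_le[OF point_imp_pre_point[OF q]]
    by (auto simp: link_def split: if_splits intro: order_trans)
  then have "(fine_step x y c)\<^sup>*\<^sup>* (into_link a b k Bot) (into_link a b k q)"
    by (intro fine_path_into_link[OF v] In.IH[OF q])
  moreover have "(fine_step x y c)\<^sup>*\<^sup>* (into_link a b 0 Bot) (into_link a b k Bot)"
    by (rule fine_path_chain[OF dist v(1-3) _ v(4) le]) simp_all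
  ultimately show ?case unfolding into_link_eq_In[OF In.prems(1)] by simp
qed (auto intro: fine_path_whole[OF dist])

lemma fine_path_to_Top:
  fixes c :: "'a::bounded_semilattice_sup_bot"
  assumes dist: "distributive_semilattice TYPE('a)"
  shows "point c p \<Longrightarrow> below_top c p \<le> x \<squnion> y \<Longrightarrow> (fine_step x y c)\<^sup>*\<^sup>* p Top"
proof (induction p arbitrary: c)
  case (In a b k p)
  have v: "a \<squnion> b = c" "a \<noteq> bot" "b \<noteq> bot" "k < 4" and p: "point (link a b k) p" using In.prems by auto
  have le: "link a b j \<le> x \<squnion> y" if "k < j" "j < 4" for j
  proof -
    have "k < 2 \<or> (k = 2 \<and> j = 3)" using that by linarith
    then show ?thesis using In.prems(2) v(1) by (auto simp: link_def split: if_splits)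
  qed
  have "below_top (link a b k) p \<le> x \<squnion> y"
    using In.prems(2) v(1,4) below_top_le[OF point_imp_pre_point[OF p]]
    by (auto simp: link_def split: if_splits intro: order_trans)
  then have 1: "(fine_step x y c)\<^sup>*\<^sup>* (into_link a b k p) (into_link a b k Top)"
    by (intro fine_path_into_link[OF v] In.IH[OF p])
  show ?case
  proof (cases "k = 3")
    case True
    then show ?thesis using 1 unfolding into_link_eq_In[OF In.prems(1)] by simp
  next
    case False
    then have "into_link a b k Top = into_link a b (Suc k) Bot" by simp
    moreover have "(fine_step x y c)\<^sup>*\<^sup>* (into_link a b (Suc k) Bot) (into_link a b 3 Bot)"
      using fine_path_chain[OF dist v(1-3), of "Suc k" 3] le v(4) False by simp
    moreover have "(fine_step x y c)\<^sup>*\<^sup>* (into_link a b 3 Bot) (into_link a b 3 Top)"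
      using le[of 3] v(4) False by (intro fine_path_into_link[OF v(1-3)] fine_path_whole[OF dist]) auto
    ultimately show ?thesis using 1 unfolding into_link_eq_In[OF In.prems(1)]
      by (metis into_link.simps(2) rtranclp_trans)
  qed
qed (auto intro: fine_path_whole[OF dist])

text \<open>
  Between comparable points there are finitely many whole links and, at the two ends, pieces of links
  that are handled recursively; all their gaps are bounded by the gap of the pair.
\<close>

lemma fine_path:
  fixes c :: "'a::bounded_semilattice_sup_bot"
  assumes dist: "distributive_semilattice TYPE('a)"
  shows "point c p \<Longrightarrow> point c q \<Longrightarrow> pt_le p q \<Longrightarrow> gap c q p \<le> x \<squnion> y \<Longrightarrow> (fine_step x y c)\<^sup>*\<^sup>* p q"
proof (induction p arbitrary: c q)
  case Bot
  then show ?case using fine_path_from_Bot[OF dist] by (simp add: gap_rules)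
next
  case Top
  then show ?case by (simp add: pt_le_from_Top)
next
  case (In a b k p c Q)
  have v: "a \<squnion> b = c" "a \<noteq> bot" "b \<noteq> bot" "k < 4" and p: "point (link a b k) p" using In.prems by auto
  show ?case
  proof (cases Q)
    case Top
    then show ?thesis using fine_path_to_Top[OF dist] In.prems by (simp add: gap_rules)
  next
    case Q: (In a' b' l q)
    then have e[simp]: "a' = a" "b' = b" and l: "l < 4" and q: "point (link a b l) q"
      and kl: "k < l \<or> k = l \<and> pt_le p q" using In.prems by auto
    have P: "into_link a b k p = In a b k p" "into_link a b l q = Q"
      using into_link_eq_In In.prems(1,2) Q by auto
    show ?thesis
    proof (cases "k = l")
      case True
      then have "(fine_step x y c)\<^sup>*\<^sup>* (into_link a b k p) (into_link a b k q)"
        using q kl In.prems(4) Q by (intro fine_path_into_link[OF v] In.IH[OF p]) (auto simp: gap_rules)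
      then show ?thesis using True P by simp
    next
      case False
      then have kl: "k < l" using kl by simp
      then have g: "above_bot (link a b l) q \<le> x \<squnion> y" "below_top (link a b k) p \<le> x \<squnion> y"
        "Suc k < l \<Longrightarrow> b \<le> x \<squnion> y"
        using In.prems(4) Q by (auto simp: gap_rules)
      have "(fine_step x y c)\<^sup>*\<^sup>* (into_link a b k p) (into_link a b k Top)"
        by (intro fine_path_into_link[OF v] fine_path_to_Top[OF dist p] g)
      moreover have "into_link a b k Top = into_link a b (Suc k) Bot" using kl l by simp
      moreover have "(fine_step x y c)\<^sup>*\<^sup>* (into_link a b (Suc k) Bot) (into_link a b l Bot)"
      proof (rule fine_path_chain[OF dist v(1-3)])
        show "link a b j \<le> x \<squnion> y" if "Suc k \<le> j" "j < l" for j
          using that g(3) l by (auto simp: link_def)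
      qed (use kl l in auto)
      moreover have "(fine_step x y c)\<^sup>*\<^sup>* (into_link a b l Bot) (into_link a b l q)"
        by (intro fine_path_into_link[OF v(1-3) l] fine_path_from_Bot[OF dist q] g)
      ultimately show ?thesis unfolding P by (metis rtranclp_trans)
    qed
  qed (use In.prems(3) in simp)
qed

section \<open>Gluing intervals\<close>

text \<open>
  Intervals of various gaps are glued together at their least points: \<open>(c, p)\<close> is the point \<open>p\<close> of the
  interval of gap \<open>c\<close>. Going from one interval to another leads through the common least point, which
  has the unique name \<open>(bot, Bot)\<close>.
\<close>

fun bouquet_le :: "'a \<times> 'a pt \<Rightarrow> 'a \<times> 'a pt \<Rightarrow> bool" where
  "bouquet_le (c, p) (d, q) \<longleftrightarrow> p = Bot \<or> c = d \<and> pt_le p q"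

fun bouquet_gap :: "'a::bounded_semilattice_sup_bot \<times> 'a pt \<Rightarrow> 'a \<times> 'a pt \<Rightarrow> 'a" where
  "bouquet_gap (c, p) (d, q) = (if c = d then gap c p q else above_bot c p)"

definition bouquet :: "'a::bounded_semilattice_sup_bot set \<Rightarrow> ('a \<times> 'a pt) set" where
  "bouquet R = insert (bot, Bot) {(c, p). c \<in> R \<and> c \<noteq> bot \<and> p \<noteq> Bot \<and> point c p}"

text \<open>
  The inclusion of the interval of gap \<open>c\<close>.
\<close>

definition petal :: "'a::bounded_semilattice_sup_bot \<Rightarrow> 'a pt \<Rightarrow> 'a \<times> 'a pt" where
  "petal c p = (if p = Bot then (bot, Bot) else (c, p))"

lemma petal_mem: "c \<in> R \<Longrightarrow> c \<noteq> bot \<Longrightarrow> point c p \<Longrightarrow> petal c p \<in> bouquet R"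
  by (simp add: petal_def bouquet_def)

lemma bouquet_cases:
  assumes "x \<in> bouquet R"
  obtains "x = (bot, Bot)" | c p where "x = (c, p)" "c \<in> R" "c \<noteq> bot" "p \<noteq> Bot" "point c p"
  using assms by (auto simp: bouquet_def)

lemma bouquet_le_refl: "bouquet_le x x"
  by (cases x) (simp add: pt_le_refl)

lemma bouquet_le_trans: "bouquet_le x y \<Longrightarrow> bouquet_le y z \<Longrightarrow> bouquet_le x z"
  by (cases x; cases y; cases z) (auto intro: pt_le_trans simp: pt_le_to_Bot)

lemma bouquet_le_antisym:
  assumes "x \<in> bouquet R" "y \<in> bouquet R" "bouquet_le x y" "bouquet_le y x"
  shows "x = y"
  using assms by (auto simp: bouquet_def pt_le_antisym)

lemma bouquet_inf_exists:
  assumes "x \<in> bouquet R" "y \<in> bouquet R"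
  shows "\<exists>m \<in> bouquet R. \<forall>z \<in> bouquet R. bouquet_le z m \<longleftrightarrow> bouquet_le z x \<and> bouquet_le z y"
proof -
  have trivial: ?thesis if z: "\<And>z. z \<in> bouquet R \<Longrightarrow> bouquet_le z x \<Longrightarrow> bouquet_le z y \<Longrightarrow> snd z = Bot"
  proof (intro bexI[of _ "(bot, Bot)"] ballI)
    fix z assume "z \<in> bouquet R"
    have "bouquet_le z (bot, Bot) \<longleftrightarrow> snd z = Bot" by (cases z) (auto simp: pt_le_to_Bot)
    moreover have "snd z = Bot \<Longrightarrow> bouquet_le z w" for w by (cases z; cases w) simp
    ultimately show "bouquet_le z (bot, Bot) \<longleftrightarrow> bouquet_le z x \<and> bouquet_le z y"
      using assms z[OF \<open>z \<in> bouquet R\<close>] by blast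
  qed (simp add: bouquet_def)
  show ?thesis
  proof (cases rule: bouquet_cases[OF assms(1)])
    case 1
    then show ?thesis by (intro trivial) (auto simp: pt_le_to_Bot)
  next
    case x: (2 c p)
    show ?thesis
    proof (cases rule: bouquet_cases[OF assms(2)])
      case 1
      then show ?thesis by (intro trivial) (auto simp: pt_le_to_Bot)
    next
      case y: (2 d q)
      show ?thesis
      proof (cases "c = d")
        case False
        then show ?thesis using x y by (intro trivial) auto
      next
        case True
        then obtain m where m: "point c m" "\<And>r. point c r \<Longrightarrow> pt_le r m \<longleftrightarrow> pt_le r p \<and> pt_le r q"
          using point_inf_exists x y by blast
        have "bouquet_le z (petal c m) \<longleftrightarrow> bouquet_le z x \<and> bouquet_le z y" if "z \<in> bouquet R" for z
          using that x y True m(2) by (auto simp: bouquet_def petal_def pt_le_to_Bot)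
        then show ?thesis using petal_mem x m(1) by blast
      qed
    qed
  qed
qed

lemma bouquet_sup_exists:
  assumes "x \<in> bouquet {u}" "y \<in> bouquet {u}"
  shows "\<exists>m \<in> bouquet {u}. \<forall>z \<in> bouquet {u}. bouquet_le m z \<longleftrightarrow> bouquet_le x z \<and> bouquet_le y z"
proof (cases rule: bouquet_cases[OF assms(1)])
  case 1
  then show ?thesis using assms(2) by (intro bexI[of _ y]) (auto simp: bouquet_le_refl)
next
  case x: (2 c p)
  show ?thesis
  proof (cases rule: bouquet_cases[OF assms(2)])
    case 1
    then show ?thesis using assms(1) by (intro bexI[of _ x]) (auto simp: bouquet_le_refl)
  next
    case y: (2 d q)
    with x obtain m where m: "point u m" "\<And>r. point u r \<Longrightarrow> pt_le m r \<longleftrightarrow> pt_le p r \<and> pt_le q r"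
      using point_sup_exists[of u p q] by auto
    then have "m \<noteq> Bot" using x y m(2)[of m] by (auto simp: pt_le_refl pt_le_to_Bot)
    then have "bouquet_le (petal u m) z \<longleftrightarrow> bouquet_le x z \<and> bouquet_le y z" if "z \<in> bouquet {u}" for z
      using that x y m(2) by (auto simp: bouquet_def petal_def)
    then show ?thesis using petal_mem[of u "{u}" m] x m(1) by (intro bexI[of _ "petal u m"]) auto
  qed
qed

lemma bouquet_gap_triangle:
  fixes R :: "'a::bounded_semilattice_sup_bot set"
  assumes dist: "distributive_semilattice TYPE('a)"
    and "x \<in> bouquet R" "y \<in> bouquet R" "z \<in> bouquet R"
  shows "bouquet_gap x z \<le> sup (bouquet_gap x y) (bouquet_gap y z)"
proof -
  have pre: "pre_point (fst w) (snd w)" if "w \<in> bouquet R" for w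
    using that by (auto simp: bouquet_def point_imp_pre_point)
  obtain c p d q e r where xyz: "x = (c, p)" "y = (d, q)" "z = (e, r)" by (metis surj_pair)
  then have w: "pre_point c p" "pre_point d q" "pre_point e r" using pre assms(2-4) by auto
  show ?thesis
    using xyz w gap_triangle[OF dist, of c p q r] above_bot_gap[OF dist, of c p q] gap_le[OF dist, of c p r]
    by (auto intro: le_supI1)
qed

lemma bouquet_gap_eq_bot_if_le: "bouquet_le x y \<Longrightarrow> bouquet_gap x y = bot"
  by (cases x; cases y) (auto simp: gap_eq_bot_if_le gap_rules)

lemma bouquet_gap_nonzero:
  assumes "x \<in> bouquet R" "y \<in> bouquet R" "bouquet_le x y" "x \<noteq> y"
  shows "bouquet_gap y x \<noteq> bot"
proof (cases rule: bouquet_cases[OF assms(2)])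
  case 1
  then show ?thesis using assms by (auto simp: bouquet_def pt_le_to_Bot)
next
  case y: (2 c q)
  show ?thesis
  proof (cases rule: bouquet_cases[OF assms(1)])
    case 1
    then show ?thesis using y above_bot_nonzero by (auto simp: gap_rules)
  next
    case (2 d p)
    then show ?thesis using y assms(3,4) gap_nonzero[of c p q] by auto
  qed
qed

lemma bouquet_fine_path:
  fixes R :: "'a::bounded_semilattice_sup_bot set"
  assumes dist: "distributive_semilattice TYPE('a)"
    and "x \<in> bouquet R" "y \<in> bouquet R" "bouquet_le x y" "bouquet_gap y x \<le> sup a b"
  shows "(\<lambda>v w. v \<in> bouquet R \<and> w \<in> bouquet R \<and> bouquet_le v w \<and>
    (bouquet_gap w v \<le> a \<or> bouquet_gap w v \<le> b))\<^sup>*\<^sup>* x y"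
    (is "?S\<^sup>*\<^sup>* x y")
proof (cases rule: bouquet_cases[OF assms(3)])
  case 1
  then have "x = y" using assms(2,4) by (auto simp: bouquet_def pt_le_to_Bot)
  then show ?thesis by simp
next
  case y: (2 c q)
  obtain p where p: "point c p" "x = petal c p" "y = petal c q" "pt_le p q"
    using assms(2,4) y by (cases rule: bouquet_cases[OF assms(2)]) (auto simp: petal_def, metis point.simps(1) pt_le.simps(1))
  have gap_petal: "bouquet_gap (petal c s) (petal c r) = gap c s r" for r s
    by (auto simp: petal_def gap_rules)
  have "(fine_step a b c)\<^sup>*\<^sup>* p q"
    using fine_path[OF dist p(1) y(5) p(4)] assms(5) gap_petal p by simp
  then have "?S\<^sup>*\<^sup>* (petal c p) (petal c q)"
  proof (induction rule: rtranclp_induct)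
    case (step r s)
    have "?S (petal c r) (petal c s)"
      using step(2) petal_mem[OF y(2,3)] gap_petal[of s r]
      by (auto simp: fine_step_def) (auto simp: petal_def pt_le_to_Bot)
    then show ?case using step(3) by (rule rtranclp.rtrancl_into_rtrancl[rotated])
  qed simp
  then show ?thesis using p by simp
qed

text \<open>
  Either \<open>a\<close> is the gap of an entire interval, or the decomposition \<open>u = a \<squnion> u\<close> of the
  only interval provides a node of gap \<open>a\<close> above \<open>Bot\<close>.
\<close>

lemma generates_bouquet:
  assumes "R = UNIV \<or> R = {u} \<and> (\<forall>a. a \<le> u)"
  shows "\<exists>x \<in> bouquet R. bouquet_gap x (bot, Bot) = (a::'a::bounded_semilattice_sup_bot)"
proof (cases "a = bot")
  case True
  then show ?thesis by (intro bexI[of _ "(bot, Bot)"]) (auto simp: gap_rules bouquet_def)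
next
  case a: False
  from assms show ?thesis
  proof
    assume "R = UNIV"
    then show ?thesis using a by (intro bexI[of _ "(a, Top)"]) (auto simp: gap_rules bouquet_def)
  next
    assume u: "R = {u} \<and> (\<forall>a. a \<le> u)"
    then have "u \<noteq> bot" using a by (metis bot.extremum_uniqueI)
    moreover have "sup a u = u" using u by (simp add: sup.absorb2)
    ultimately show ?thesis
      using a u by (intro bexI[of _ "(u, In a u 1 Bot)"]) (auto simp: gap_rules bouquet_def)
  qed
qed

section \<open>Transport to lists\<close>

fun encode_point :: "'a pt \<Rightarrow> ('a + nat) list" where
  "encode_point Bot = [Inr 0]"
| "encode_point Top = [Inr 1]"
| "encode_point (In a b k p) = Inl a # Inl b # Inr k # encode_point p"

lemma inj_encode_point: "encode_point p = encode_point q \<Longrightarrow> p = q"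
proof (induction p arbitrary: q)
  case (In a b k p)
  then show ?case by (cases q) auto
qed (case_tac q; simp)+

definition encode :: "'a \<times> 'a pt \<Rightarrow> ('a + nat) list" where
  "encode x = Inl (fst x) # encode_point (snd x)"

lemma inj_encode: "inj encode"
  by (rule injI) (auto simp: encode_def prod_eq_iff inj_encode_point)

text \<open>
  The loop at \<open>x\<close> makes the length positive when \<open>x = y\<close>.
\<close>

lemma indexed_path:
  assumes "R\<^sup>*\<^sup>* x y" "R x x"
  shows "\<exists>(n::nat) z. n > 0 \<and> z 0 = x \<and> z n = y \<and> (\<forall>i<n. R (z i) (z (Suc i)))"
proof -
  have "R\<^sup>+\<^sup>+ x y" using assms by (metis rtranclpD tranclp.r_into_trancl)
  then show ?thesis by (auto simp: tranclp_power relpowp_fun_conv)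
qed

definition bouquet_order :: "'a::bounded_semilattice_sup_bot set \<Rightarrow> ('a + nat) list gorder" where
  "bouquet_order R = \<lparr>carrier = encode ` bouquet R, eq = (=),
     le = (\<lambda>v w. bouquet_le (inv encode v) (inv encode w))\<rparr>"

lemma carrier_bouquet_order: "carrier (bouquet_order R) = encode ` bouquet R"
  and eq_bouquet_order: "eq (bouquet_order R) = (=)"
  and le_bouquet_order: "encode x \<sqsubseteq>\<^bsub>bouquet_order R\<^esub> encode y \<longleftrightarrow> bouquet_le x y"
  by (simp_all add: bouquet_order_def inj_encode)

lemmas bouquet_order_simps = carrier_bouquet_order eq_bouquet_order le_bouquet_order

lemma partial_order_bouquet: "partial_order (bouquet_order R)"
proof unfold_locales
  fix x y z
  assume "x \<in> carrier (bouquet_order R)" "y \<in> carrier (bouquet_order R)" "z \<in> carrier (bouquet_order R)"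
    and "x \<sqsubseteq>\<^bsub>bouquet_order R\<^esub> y" "y \<sqsubseteq>\<^bsub>bouquet_order R\<^esub> z"
  then show "x \<sqsubseteq>\<^bsub>bouquet_order R\<^esub> z"
    by (auto simp only: bouquet_order_simps intro: bouquet_le_trans)
qed (auto simp: bouquet_order_simps bouquet_le_refl simp del: bouquet_le.simps dest: bouquet_le_antisym)

lemma least_bouquet: "least (bouquet_order R) (encode (bot, Bot)) (carrier (bouquet_order R))"
  by (auto simp: least_def bouquet_order_simps) (auto simp: bouquet_def)

lemma lower_semilattice_bouquet: "lower_semilattice (bouquet_order R)"
proof -
  interpret partial_order "bouquet_order R" by (rule partial_order_bouquet)
  show ?thesis
  proof
    fix x y assume "x \<in> carrier (bouquet_order R)" "y \<in> carrier (bouquet_order R)"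
    then obtain v w where vw: "x = encode v" "y = encode w" "v \<in> bouquet R" "w \<in> bouquet R"
      by (auto simp: bouquet_order_simps)
    then obtain m where "m \<in> bouquet R"
      "\<forall>z \<in> bouquet R. bouquet_le z m \<longleftrightarrow> bouquet_le z v \<and> bouquet_le z w"
      using bouquet_inf_exists by blast
    then show "\<exists>s. greatest (bouquet_order R) s (Lower (bouquet_order R) {x, y})"
      using vw bouquet_le_refl[of m] by (intro exI[of _ "encode m"])
        (auto simp: greatest_def Lower_def bouquet_order_simps)
  qed
qed

lemma bounded_lattice_bouquet: "bounded_lattice (bouquet_order {u})"
proof -
  interpret lower_semilattice "bouquet_order {u}" by (rule lower_semilattice_bouquet)
  show ?thesis
  proof
    fix x y assume "x \<in> carrier (bouquet_order {u})" "y \<in> carrier (bouquet_order {u})"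
    then obtain v w where vw: "x = encode v" "y = encode w" "v \<in> bouquet {u}" "w \<in> bouquet {u}"
      by (auto simp: bouquet_order_simps)
    then obtain m where "m \<in> bouquet {u}"
      "\<forall>z \<in> bouquet {u}. bouquet_le m z \<longleftrightarrow> bouquet_le v z \<and> bouquet_le w z"
      using bouquet_sup_exists by blast
    then show "\<exists>s. least (bouquet_order {u}) s (Upper (bouquet_order {u}) {x, y})"
      using vw bouquet_le_refl[of m] by (intro exI[of _ "encode m"])
        (auto simp: least_def Upper_def bouquet_order_simps)
  next
    show "\<exists>x. least (bouquet_order {u}) x (carrier (bouquet_order {u}))"
      using least_bouquet by blast
  next
    define t where "t = (if u = bot then (bot, Bot) else (u, Top :: 'a pt))"
    have "t \<in> bouquet {u} \<and> (\<forall>x \<in> bouquet {u}. bouquet_le x t)"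
      by (auto simp: t_def bouquet_def pt_le_to_Top)
    then show "\<exists>x. greatest (bouquet_order {u}) x (carrier (bouquet_order {u}))"
      by (intro exI[of _ "encode t"]) (auto simp: greatest_def bouquet_order_simps)
  qed
qed

section \<open>The representation theorem\<close>

theorem corollary10p4:
  assumes "distributive_semilattice TYPE('a::bounded_semilattice_sup_bot)"
  shows "\<exists>(P :: ('a + nat) list gorder) (m :: ('a + nat) list \<Rightarrow> ('a + nat) list \<Rightarrow> 'a).
    lower_semilattice P \<and> weak_partial_order_bottom P \<and> p_measure P m \<and>
    (\<forall>x \<in> carrier P. \<forall>y \<in> carrier P. x \<sqsubset>\<^bsub>P\<^esub> y \<longrightarrow> eq_measure P m y x > bot) \<and>
    (\<forall>x \<in> carrier P. \<forall>y \<in> carrier P. \<forall>a b. x \<sqsubseteq>\<^bsub>P\<^esub> y \<longrightarrow> eq_measure P m y x \<le> sup a b \<longrightarrow>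
      (\<exists>(n::nat) z. n > 0 \<and> (\<forall>i\<le>n. z i \<in> carrier P) \<and> z 0 = x \<and> z n = y \<and>
        (\<forall>i<n. z i \<sqsubseteq>\<^bsub>P\<^esub> z (Suc i)) \<and>
        (\<forall>i<n. eq_measure P m (z (Suc i)) (z i) \<le> a \<or> eq_measure P m (z (Suc i)) (z i) \<le> b))) \<and>
    generates_semilattice {eq_measure P m x \<bottom>\<^bsub>P\<^esub> | x. x \<in> carrier P} \<and>
    ((\<exists>u::'a. \<forall>a. a \<le> u) \<longrightarrow> bounded_lattice P)"
proof -
  obtain R :: "'a set" where R: "R = UNIV \<or> (\<exists>u. R = {u} \<and> (\<forall>a. a \<le> u))"
    and bounded: "(\<exists>u. \<forall>a::'a. a \<le> u) \<Longrightarrow> \<exists>u. R = {u}"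
  proof (cases "\<exists>u. \<forall>a::'a. a \<le> u")
    case True
    then obtain u where "\<forall>a::'a. a \<le> u" ..
    then show thesis by (intro that[of "{u}"]) auto
  next
    case False
    then show thesis by (intro that[of UNIV]) simp_all
  qed
  let ?P = "bouquet_order R"
  define m where "m v w = bouquet_gap (inv encode v) (inv encode w)" for v w :: "('a + nat) list"
  have m: "m (encode x) (encode y) = bouquet_gap x y" for x y by (simp add: m_def inj_encode)
  interpret lower_semilattice ?P by (rule lower_semilattice_bouquet)
  interpret weak_partial_order_bottom ?P by unfold_locales (use least_bouquet in blast)
  have eq: "eq_measure ?P m (encode y) (encode x) = bouquet_gap y x"
    if "x \<in> bouquet R" "y \<in> bouquet R" "bouquet_le x y" for x y
    using that by (auto simp: eq_measure_def le_bouquet_order m dest: bouquet_le_antisym)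
  have p: "p_measure ?P m"
    using bouquet_gap_triangle[OF assms] bouquet_gap_eq_bot_if_le
    by (auto simp: p_measure_def bouquet_order_simps m simp del: bouquet_le.simps bouquet_gap.simps)
  have pos: "eq_measure ?P m y x > bot"
    if xy: "x \<in> carrier ?P" "y \<in> carrier ?P" "x \<sqsubset>\<^bsub>?P\<^esub> y" for x y
  proof -
    obtain v w where vw: "x = encode v" "y = encode w" "v \<in> bouquet R" "w \<in> bouquet R"
      using xy(1,2) unfolding carrier_bouquet_order by blast
    then have "bouquet_le v w" "v \<noteq> w" using xy(3) by (auto simp: lless_eq le_bouquet_order)
    then have "bouquet_gap w v \<noteq> bot" using bouquet_gap_nonzero vw by blast
    then have "bot < bouquet_gap w v" by (simp only: bot.not_eq_extremum)
    then show ?thesis using eq[of v w] vw \<open>bouquet_le v w\<close> by simp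
  qed
  have path: "\<exists>(n::nat) z. n > 0 \<and> (\<forall>i\<le>n. z i \<in> carrier ?P) \<and> z 0 = x \<and> z n = y \<and>
        (\<forall>i<n. z i \<sqsubseteq>\<^bsub>?P\<^esub> z (Suc i)) \<and>
        (\<forall>i<n. eq_measure ?P m (z (Suc i)) (z i) \<le> a \<or> eq_measure ?P m (z (Suc i)) (z i) \<le> b)"
    if xy: "x \<in> carrier ?P" "y \<in> carrier ?P" "x \<sqsubseteq>\<^bsub>?P\<^esub> y" "eq_measure ?P m y x \<le> sup a b" for x y a b
  proof -
    obtain v w where vw: "x = encode v" "y = encode w" "v \<in> bouquet R" "w \<in> bouquet R"
      using xy(1,2) unfolding carrier_bouquet_order by blast
    let ?S = "\<lambda>v w. v \<in> bouquet R \<and> w \<in> bouquet R \<and> bouquet_le v w \<and>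
      (bouquet_gap w v \<le> a \<or> bouquet_gap w v \<le> b)"
    have "?S\<^sup>*\<^sup>* v w"
      using xy vw eq by (intro bouquet_fine_path[OF assms]) (auto simp: bouquet_order_simps)
    moreover have "?S v v" using vw by (simp add: bouquet_le_refl bouquet_gap_eq_bot_if_le)
    ultimately obtain n z where z: "n > 0" "z 0 = v" "z n = w" "\<forall>i<n. ?S (z i) (z (Suc i))"
      using indexed_path[of ?S v w] by blast
    have zR: "z i \<in> bouquet R" if "i \<le> n" for i
      using z vw(4) that by (cases "i = n") auto
    show ?thesis
      using z vw zR eq by (intro exI[of _ n] exI[of _ "\<lambda>i. encode (z i)"])
        (auto simp: bouquet_order_simps)
  qed
  have gen: "generates_semilattice {eq_measure ?P m x \<bottom>\<^bsub>?P\<^esub> | x. x \<in> carrier ?P}"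
  proof -
    have B: "\<bottom>\<^bsub>?P\<^esub> = encode (bot, Bot)"
      using least_unique[OF bottom_least least_bouquet] .
    have "a \<in> {eq_measure ?P m x \<bottom>\<^bsub>?P\<^esub> | x. x \<in> carrier ?P}" for a
    proof -
      obtain x where x: "x \<in> bouquet R" "bouquet_gap x (bot, Bot) = a"
        using generates_bouquet[of R _ a] R by blast
      then have "eq_measure ?P m (encode x) \<bottom>\<^bsub>?P\<^esub> = a"
        unfolding B using eq[of "(bot, Bot)" x] by (cases x) (simp add: bouquet_def)
      then show ?thesis using x(1) by (force simp: carrier_bouquet_order)
    qed
    then show ?thesis
      unfolding generates_semilattice_def by (intro UNIV_eq_I[symmetric] hull_inc)
  qed
  have lattice: "bounded_lattice ?P" if "\<exists>u::'a. \<forall>a. a \<le> u"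
    using bounded[OF that] bounded_lattice_bouquet by auto
  show ?thesis
    by (intro exI[of _ ?P] exI[of _ m] conjI ballI allI impI lower_semilattice_axioms
        weak_partial_order_bottom_axioms p gen; (erule lattice | rule pos path; assumption))
qed

end
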